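(* Let $\boldsymbol{B}\in\mathbb{R}^{n\times(m+n)}$ be a constant matrix and $\boldsymbol{g}\in\mathbb{R}^n$ a vector such that $$\mathrm{rank}(\boldsymbol{B}\boldsymbol{V}_3\boldsymbol{T}_+)=n_+,\qquad \boldsymbol{g}\in\mathrm{span}\{\boldsymbol{B}\boldsymbol{V}_3\boldsymbol{T}_+\}.$$ Then the system $$\boldsymbol{A}\frac{\mathrm{d}\boldsymbol{w}(y)}{\mathrm{d}y}=-\boldsymbol{Q}\boldsymbol{w}(y),\quad y\in[0,+\infty),\qquad \boldsymbol{w}(+\infty)=\boldsymbol{0},$$ with the boundary condition $$\boldsymbol{B}\boldsymbol{V}_3(\boldsymbol{V}_3^T\boldsymbol{w}(0))=\boldsymbol{g}$$ has a unique solution $\boldsymbol{w}(y)\in\mathbb{R}^{m+n}$. Moreover, the solution is given explicitly by $$\boldsymbol{V}_2^T\boldsymbol{w}(y)=\boldsymbol{0},$$ $$\boldsymbol{V}_3^T\boldsymbol{w}(y)=\boldsymbol{T}_+\exp\left(-\boldsymbol{\Lambda}_+^{-1}y\right)\boldsymbol{z}(0),$$ $$\boldsymbol{V}_1^T\boldsymbol{w}(y)=-\boldsymbol{A}_{21}^{-1}\boldsymbol{U}_2^T\boldsymbol{A}\boldsymbol{V}_3(\boldsymbol{V}_3^T\boldsymbol{w}(y))+\int_y^{+\infty}\boldsymbol{A}_{21}^{-1}\boldsymbol{U}_2^T\boldsymbol{Q}\boldsymbol{V}_3(\boldsymbol{V}_3^T\boldsymbol{w}(s))\,\mathrm{d}s,$$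 where $\boldsymbol{A}_{21}=\boldsymbol{U}_2^T\boldsymbol{A}\boldsymbol{V}_1$ and $\boldsymbol{z}(0)\in\mathbb{R}^{n_+}$ is the unique solution of the linear algebraic system $\boldsymbol{B}\boldsymbol{V}_3(\boldsymbol{T}_+\boldsymbol{z}(0))=\boldsymbol{g}$.
   Context: Let $m\ge n$ and $$\boldsymbol{A}=\begin{bmatrix}\boldsymbol{0}&\boldsymbol{M}\\ \boldsymbol{M}^T&\boldsymbol{0}\end{bmatrix},\qquad \boldsymbol{Q}=\begin{bmatrix}\boldsymbol{Q}_e&\boldsymbol{0}\\ \boldsymbol{0}&\boldsymbol{Q}_o\end{bmatrix},$$ where $\boldsymbol{M}\in\mathbb{R}^{m\times n}$ has full column rank $n$, $\boldsymbol{Q}_e\in\mathbb{R}^{m\times m}$ and $\boldsymbol{Q}_o\in\mathbb{R}^{n\times n}$ are symmetric positive semi-definite, and $\mathrm{Null}(\boldsymbol{A})\cap\mathrm{Null}(\boldsymbol{Q})=\{\boldsymbol{0}\}$. For a matrix $\boldsymbol{C}$, $\mathrm{span}\{\boldsymbol{C}\}$ denotes its column space. "Column orthogonal" means having orthonormal columns. $\boldsymbol{w}(+\infty)$ denotes $\lim_{y\to+\infty}\boldsymbol{w}(y)$. Let $\boldsymbol{G}\in\mathbb{R}^{(m+n)\times p}$ be an orthonormal basis matrix of $\mathrm{Null}(\boldsymbol{Q})$ (column orthogonal, columns a basis), and let $\boldsymbol{X}\in\mathbb{R}^{p\times r}$ be an orthonormal basis matrix of $\mathrm{Null}(\boldsymbol{G}^T\boldsymbol{A}\boldsymbol{G})$.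 Put $\boldsymbol{V}_1=\boldsymbol{G}\boldsymbol{X}\in\mathbb{R}^{(m+n)\times r}$, $\boldsymbol{U}_1=\boldsymbol{G}$, $\boldsymbol{U}_2=\boldsymbol{A}\boldsymbol{G}\boldsymbol{X}$. Let $\boldsymbol{V}_2\in\mathbb{R}^{(m+n)\times p}$ and $\boldsymbol{V}_3\in\mathbb{R}^{(m+n)\times(m+n-p-r)}$ be matrices (such matrices exist) satisfying: (1) $\mathrm{span}\{\boldsymbol{V}_2\}=\mathrm{span}\{\boldsymbol{A}\boldsymbol{G}\}$; (2) $\boldsymbol{V}=[\boldsymbol{V}_1,\boldsymbol{V}_2,\boldsymbol{V}_3]$ is orthogonal and $\boldsymbol{U}=[\boldsymbol{U}_1,\boldsymbol{U}_2,\boldsymbol{V}_3]$ is invertible; (3) $\mathrm{rank}(\boldsymbol{U}_2^T\boldsymbol{A}\boldsymbol{V}_1)=r$, $\boldsymbol{V}_3^T\boldsymbol{A}\boldsymbol{V}_1=\boldsymbol{0}$ and $\boldsymbol{V}_3^T\boldsymbol{Q}\boldsymbol{V}_3$ is symmetric positive definite. Put $\boldsymbol{Q}_{33}=\boldsymbol{V}_3^T\boldsymbol{Q}\boldsymbol{V}_3$, $\boldsymbol{A}_{33}=\boldsymbol{V}_3^T\boldsymbol{A}\boldsymbol{V}_3$. Let $n_+$ be the number of positive eigenvalues (with multiplicity) of $\boldsymbol{Q}_{33}^{-1}\boldsymbol{A}_{33}$, and let $\boldsymbol{T}_+\in\mathbb{R}^{(m+n-p-r)\times n_+}$ and a diagonal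 matrix $\boldsymbol{\Lambda}_+\in\mathbb{R}^{n_+\times n_+}$ with positive diagonal entries satisfy $$\boldsymbol{Q}_{33}^{-1}\boldsymbol{A}_{33}\boldsymbol{T}_+=\boldsymbol{T}_+\boldsymbol{\Lambda}_+,$$ the columns of $\boldsymbol{T}_+$ being linearly independent eigenvectors for the positive eigenvalues. *)

theory Defs
  imports
    "HOL-Analysis.Henstock_Kurzweil_Integration"
    "Jordan_Normal_Form.DL_Rank"
    "Jordan_Normal_Form.Matrix_Kernel"
    "Jordan_Normal_Form.Char_Poly"
begin

text \<open>
  Matrices and vectors are those of \<^verbatim>\<open>Jordan_Normal_Form\<close>, so that all dimensions are natural
  numbers and blocks without columns (or rows) are allowed.
\<close>

definition symmetric_psd :: "real mat \<Rightarrow> bool" where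
  "symmetric_psd S \<longleftrightarrow> square_mat S \<and> S\<^sup>T = S \<and>
     (\<forall>x \<in> carrier_vec (dim_row S). 0 \<le> x \<bullet> (S *\<^sub>v x))"

definition symmetric_pd :: "real mat \<Rightarrow> bool" where
  "symmetric_pd S \<longleftrightarrow> square_mat S \<and> S\<^sup>T = S \<and>
     (\<forall>x \<in> carrier_vec (dim_row S). x \<noteq> 0\<^sub>v (dim_row S) \<longrightarrow> 0 < x \<bullet> (S *\<^sub>v x))"

text \<open>
  The library predicate \<^const>\<open>orthogonal_mat\<close> only asks for nonzero, pairwise orthogonal columns;
  here the columns are orthonormal.
\<close>

definition column_orthogonal :: "real mat \<Rightarrow> bool" where
  "column_orthogonal C \<longleftrightarrow> C\<^sup>T * C = 1\<^sub>m (dim_col C)"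

definition square_orthogonal :: "real mat \<Rightarrow> bool" where
  "square_orthogonal C \<longleftrightarrow> square_mat C \<and> column_orthogonal C"

definition lin_indpt_cols :: "real mat \<Rightarrow> bool" where
  "lin_indpt_cols C \<longleftrightarrow> distinct (cols C) \<and>
     module.lin_indpt class_ring (module_vec TYPE(real) (dim_row C)) (set (cols C))"

definition orthonormal_basis_mat :: "real mat \<Rightarrow> real vec set \<Rightarrow> bool" where
  "orthonormal_basis_mat C W \<longleftrightarrow>
     column_orthogonal C \<and> lin_indpt_cols C \<and> vec_space.col_space (dim_row C) C = W"

definition append_three :: "real mat \<Rightarrow> real mat \<Rightarrow> real mat \<Rightarrow> real mat" where
  "append_three C D E = mat_of_cols (dim_row C) (cols C @ cols D @ cols E)"

text \<open>Unspecified unless \<open>C\<close> is invertible.\<close>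

definition inv_mat :: "real mat \<Rightarrow> real mat" where
  "inv_mat C = the (mat_inverse C)"

definition mat_exp :: "real mat \<Rightarrow> real mat" where
  "mat_exp C = mat (dim_row C) (dim_row C) (\<lambda>(i, j). \<Sum>k. (C ^\<^sub>m k) $$ (i, j) / fact k)"

text \<open>Number of positive eigenvalues, counted with algebraic multiplicity.\<close>

definition num_pos_eigenvalues :: "real mat \<Rightarrow> nat" where
  "num_pos_eigenvalues C = (\<Sum>a \<in> {a. eigenvalue C a \<and> 0 < a}. order a (char_poly C))"

text \<open>
  The type of vectors carries no topology (dimensions are not fixed by the type), hence
  derivatives, limits and integrals are taken componentwise.
\<close>

definition has_derivative_vec ::
    "nat \<Rightarrow> (real \<Rightarrow> real vec) \<Rightarrow> real vec \<Rightarrow> real filter \<Rightarrow> bool" where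
  "has_derivative_vec d w w' F \<longleftrightarrow> w' \<in> carrier_vec d \<and>
     (\<forall>i<d. ((\<lambda>y. w y $ i) has_real_derivative (w' $ i)) F)"

definition tendsto_vec ::
    "nat \<Rightarrow> (real \<Rightarrow> real vec) \<Rightarrow> real vec \<Rightarrow> real filter \<Rightarrow> bool" where
  "tendsto_vec d w l F \<longleftrightarrow> l \<in> carrier_vec d \<and> (\<forall>i<d. ((\<lambda>y. w y $ i) \<longlongrightarrow> l $ i) F)"

text \<open>
  On \<open>S = {y..}\<close> this is the improper integral: a Henstock-Kurzweil integral over an unbounded
  set is the limit of the integrals over bounded intervals.
\<close>

definition has_integral_vec ::
    "nat \<Rightarrow> (real \<Rightarrow> real vec) \<Rightarrow> real vec \<Rightarrow> real set \<Rightarrow> bool" where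
  "has_integral_vec d f I S \<longleftrightarrow> I \<in> carrier_vec d \<and>
     (\<forall>i<d. ((\<lambda>s. f s $ i) has_integral (I $ i)) S)"

text \<open>
  Solutions of \<open>A w' = - Q w\<close> on \<open>[0, \<infinity>)\<close> with \<open>w(+\<infinity>) = 0\<close>. Every component of \<open>w\<close> is required to
  be differentiable (one-sidedly at \<open>0\<close>), although \<open>A\<close> may be singular. Values of \<open>w\<close> at negative
  arguments are irrelevant.
\<close>

definition decaying_solution :: "real mat \<Rightarrow> real mat \<Rightarrow> (real \<Rightarrow> real vec) \<Rightarrow> bool" where
  "decaying_solution A Q w \<longleftrightarrow>
     (\<forall>y\<ge>0. w y \<in> carrier_vec (dim_col A)) \<and>
     (\<forall>y\<ge>0. \<exists>w'. has_derivative_vec (dim_col A) w w' (at y within {0..}) \<and>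
        A *\<^sub>v w' = - (Q *\<^sub>v w y)) \<and>
     tendsto_vec (dim_col A) w (0\<^sub>v (dim_col A)) at_top"

end

theory Submission
  imports Defs "Jordan_Normal_Form.Jordan_Normal_Form_Existence"
begin

text \<open>
  Idea of the proof. In the orthonormal coordinates \<open>a = V1\<^sup>T w\<close>, \<open>b = V2\<^sup>T w\<close>, \<open>c = V3\<^sup>T w\<close> the
  differential-algebraic system splits into three parts, because testing it with the invertible
  matrix \<open>U = [G, U2, V3]\<close> loses nothing.

  Testing with \<open>G\<close> gives \<open>(G\<^sup>T A w)' = - G\<^sup>T Q w = 0\<close>; a constant that tends to zero vanishes, and as
  \<open>V2\<close> and \<open>A G\<close> have the same column space, this says \<open>b = 0\<close>. Testing with \<open>V3\<close> removes \<open>a\<close>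
  (\<open>V3\<^sup>T A V1 = 0\<close> and \<open>Q V1 = 0\<close>) and leaves \<open>A33 c' = - Q33 c\<close>, that is \<open>S c' = - c\<close> with
  \<open>S = Q33\<^sup>-\<^sup>1 A33\<close>. Testing with \<open>U2\<close> gives \<open>A21 a' = - U2\<^sup>T A V3 c' - U2\<^sup>T Q V3 c\<close>, which determines
  \<open>a\<close> by integration from infinity.

  The equation for \<open>c\<close> is solved by diagonalizing \<open>S\<close> over the reals, which is possible because \<open>S\<close> is
  self-adjoint for the inner product of \<open>Q33\<close> (\<open>symmetric_pencil_diagonalizable\<close>): no eigenvalue
  can have an imaginary part and no Jordan block can be larger than one by one. In an eigenbasis the
  equation reads \<open>d f' = - f\<close>, and a decaying solution is nonzero only for \<open>d > 0\<close>, where it is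
  determined by its initial value (\<open>decaying_pencil_solution_mode\<close>). So \<open>c(0)\<close> lies in the span of
  the eigenvectors for positive eigenvalues. The algebraic multiplicities of the positive eigenvalues
  add up to the dimension of that span, hence the \<open>n_plus\<close> independent columns of \<open>T_plus\<close> fill it
  (\<open>positive_eigenvectors_span\<close>), and \<open>c(0) = T_plus z\<close> for some \<open>z\<close>.

  For uniqueness, the difference of two solutions has \<open>c(0) = T_plus z\<close> and \<open>B V3 T_plus z = 0\<close>, so
  \<open>z = 0\<close> by the rank condition, then \<open>c = 0\<close>, then \<open>a' = 0\<close> and \<open>a = 0\<close> (\<open>solution_zero\<close>). For existence,
  the stated formulas say that \<open>w(y) = W exp(- \<Lambda>\<^sup>-\<^sup>1 y) z0\<close> for one constant matrix \<open>W\<close>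
  (\<open>mode_profile\<close>), and such a function solves the system because \<open>A W = Q W \<Lambda>\<close>, an identity that can
  again be tested with \<open>U\<close> (\<open>mode_profile_equation\<close>).
\<close>

unbundle no vec_syntax

section \<open>Vectors, column spaces and inverses\<close>

lemma index_mult_mat_vec_sum:
  fixes C :: "real mat"
  assumes "C \<in> carrier_mat n d" "x \<in> carrier_vec d" "i < n"
  shows "(C *\<^sub>v x) $ i = (\<Sum>j<d. C $$ (i, j) * x $ j)"
  using assms by (simp add: scalar_prod_def lessThan_atLeast0)

lemma diagonal_mult_vec_index:
  fixes D :: "real mat"
  assumes "D \<in> carrier_mat n n" "diagonal_mat D" "x \<in> carrier_vec n" "i < n"
  shows "(D *\<^sub>v x) $ i = D $$ (i, i) * x $ i"
proof -
  have "(D *\<^sub>v x) $ i = (\<Sum>j<n. if j = i then D $$ (i, i) * x $ i else 0)"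
    unfolding index_mult_mat_vec_sum[OF assms(1,3,4)]
    using assms unfolding diagonal_mat_def by (intro sum.cong) auto
  with assms show ?thesis by simp
qed

lemma mult_mat_vec_assoc3:
  fixes C D E :: "real mat"
  assumes "C \<in> carrier_mat a b" "D \<in> carrier_mat b c" "E \<in> carrier_mat c d" "x \<in> carrier_vec d"
  shows "(C * D * E) *\<^sub>v x = C *\<^sub>v (D *\<^sub>v (E *\<^sub>v x))"
  using assoc_mult_mat_vec[OF mult_carrier_mat[OF assms(1,2)] assms(3,4)]
    assoc_mult_mat_vec[OF assms(1,2) mult_mat_vec_carrier[OF assms(3,4)]] by simp

lemma mult_zero_vec:
  fixes C :: "real mat"
  shows "C \<in> carrier_mat a b \<Longrightarrow> C *\<^sub>v 0\<^sub>v b = 0\<^sub>v a"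
  by (intro eq_vecI) (simp_all add: scalar_prod_def)

lemma zero_mat_mult_vec:
  fixes x :: "real vec"
  shows "x \<in> carrier_vec b \<Longrightarrow> 0\<^sub>m a b *\<^sub>v x = 0\<^sub>v a"
  by (intro eq_vecI) (simp_all add: scalar_prod_def)

lemma mult_mat_vec_uminus:
  fixes C :: "real mat"
  assumes "C \<in> carrier_mat a b" "x \<in> carrier_vec b"
  shows "C *\<^sub>v (- x) = - (C *\<^sub>v x)"
  using assms by (intro eq_vecI) auto

lemma eq_vec_of_diff_zero:
  fixes x y :: "real vec"
  assumes "x \<in> carrier_vec n" "y \<in> carrier_vec n" and d: "x - y = 0\<^sub>v n"
  shows "x = y"
proof (rule eq_vecI)
  fix i assume "i < dim_vec y"
  with arg_cong[OF d, of "\<lambda>v. v $ i"] assms(1,2) show "x $ i = y $ i"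
    by simp
qed (use assms in simp)

lemma col_space_memD:
  fixes C :: "real mat"
  assumes "C \<in> carrier_mat n d" and "v \<in> vec_space.col_space n C"
  obtains x where "x \<in> carrier_vec d" and "v = C *\<^sub>v x"
proof -
  interpret vec_space "TYPE(real)" n .
  from assms show thesis
    using that unfolding col_space_eq[OF assms(1)] by auto
qed

lemma col_space_memI:
  fixes C :: "real mat"
  assumes "C \<in> carrier_mat n d" and "x \<in> carrier_vec d"
  shows "C *\<^sub>v x \<in> vec_space.col_space n C"
proof -
  interpret vec_space "TYPE(real)" n .
  from assms show ?thesis
    unfolding col_space_eq[OF assms(1)] by auto
qed

lemma zero_mat_if_annihilates:
  fixes C :: "real mat"
  assumes C: "C \<in> carrier_mat a b" and z: "\<And>x. x \<in> carrier_vec b \<Longrightarrow> C *\<^sub>v x = 0\<^sub>v a"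
  shows "C = 0\<^sub>m a b"
proof (rule eq_matI)
  fix i j assume "i < dim_row (0\<^sub>m a b :: real mat)" "j < dim_col (0\<^sub>m a b :: real mat)"
  then have ij: "i < a" "j < b" by auto
  have "(C *\<^sub>v unit_vec b j) $ i = C $$ (i, j)"
    using C ij by simp
  with z[of "unit_vec b j"] ij show "C $$ (i, j) = 0\<^sub>m a b $$ (i, j)"
    by simp
qed (use C in auto)

lemma lin_indpt_cols_injective:
  assumes "C \<in> carrier_mat n k" and "lin_indpt_cols C"
    and "x \<in> carrier_vec k" and "C *\<^sub>v x = 0\<^sub>v n"
  shows "x = 0\<^sub>v k"
proof -
  interpret vec_space "TYPE(real)" n .
  show ?thesis
    using lin_depI[OF assms(1,3) _ assms(4)] assms(1,2)
    unfolding lin_indpt_cols_def by auto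
qed

text \<open>
  A repeated column would leave fewer distinct columns than the rank, so the columns are distinct and
  the library characterization of full rank for distinct columns applies.
\<close>

lemma full_rank_lin_indpt_cols:
  fixes C :: "real mat"
  assumes C: "C \<in> carrier_mat n q" and rank: "vec_space.rank n C = q"
  shows "lin_indpt_cols C"
proof -
  interpret vec_space "TYPE(real)" n .
  let ?indpt = "\<lambda>T. T \<subseteq> set (cols C) \<and> lin_indpt T"
  obtain S where S: "maximal S ?indpt"
    using maximal_exists[of ?indpt "card (set (cols C))" "{}"]
    by (meson List.finite_set card_mono empty_iff empty_subsetI finite_lin_indpt2 rev_finite_subset)
  then have "card S \<le> card (set (cols C))"
    by (simp add: card_mono maximal_def)
  then have "card (set (cols C)) = length (cols C)"
    using rank_card_indpt[OF C S] rank C card_length[of "cols C"] by simp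
  then have "distinct (cols C)"
    by (rule card_distinct)
  then show ?thesis
    using full_rank_lin_indpt[OF C rank] C unfolding lin_indpt_cols_def by auto
qed

lemma invertible_mat_det:
  fixes C :: "real mat"
  assumes C: "C \<in> carrier_mat n n" and inv: "invertible_mat C"
  shows "det C \<noteq> 0"
proof -
  obtain B where B: "C * B = 1\<^sub>m n" "B * C = 1\<^sub>m (dim_row B)"
    using inv C unfolding invertible_mat_def inverts_mat_def by auto
  have "dim_col B = n" using arg_cong[OF B(1), of dim_col] by simp
  moreover have "dim_row B = n" using arg_cong[OF B(2), of dim_col] C by simp
  ultimately have "B \<in> carrier_mat n n" by auto
  from det_mult[OF C this] B(1) show ?thesis by auto
qed

lemma det_nonzero_inv_mat:
  assumes "C \<in> carrier_mat k k" and "det C \<noteq> 0"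
  shows "inv_mat C \<in> carrier_mat k k" "C * inv_mat C = 1\<^sub>m k" "inv_mat C * C = 1\<^sub>m k"
proof -
  have "C \<in> Units (ring_mat TYPE(real) k ())"
    using det_non_zero_imp_unit[OF assms] .
  then obtain D where "mat_inverse C = Some D"
    using mat_inverse(1)[OF assms(1), where b = "()"] by (cases "mat_inverse C") auto
  with mat_inverse(2)[OF assms(1) this]
  show "inv_mat C \<in> carrier_mat k k" "C * inv_mat C = 1\<^sub>m k" "inv_mat C * C = 1\<^sub>m k"
    unfolding inv_mat_def by auto
qed

lemma inv_mat_eqI:
  assumes "C \<in> carrier_mat k k" and "D \<in> carrier_mat k k" and "C * D = 1\<^sub>m k"
  shows "inv_mat C = D"
proof -
  have "det C \<noteq> 0"
    using det_mult[OF assms(1,2)] assms(3) by auto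
  note inv = det_nonzero_inv_mat[OF assms(1) this]
  have "inv_mat C = inv_mat C * (C * D)"
    using inv assms by simp
  also have "\<dots> = inv_mat C * C * D"
    using assoc_mult_mat[OF inv(1) assms(1,2)] by simp
  also have "\<dots> = D"
    unfolding inv(3) using assms(2) by simp
  finally show ?thesis .
qed

lemma symmetric_form_swap:
  fixes C :: "real mat"
  assumes "C \<in> carrier_mat k k" "C\<^sup>T = C" "x \<in> carrier_vec k" "y \<in> carrier_vec k"
  shows "x \<bullet> (C *\<^sub>v y) = y \<bullet> (C *\<^sub>v x)"
  using transpose_vec_mult_scalar[OF assms(1,4,3)] assms
  by (simp add: comm_scalar_prod[of "C *\<^sub>v x" k])

lemma symmetric_pd_det:
  assumes "C \<in> carrier_mat k k" and "symmetric_pd C"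
  shows "det C \<noteq> 0"
  using assms det_0_iff_vec_prod_zero_field[OF assms(1)]
  unfolding symmetric_pd_def by fastforce

lemma symmetric_pdD:
  assumes "C \<in> carrier_mat k k" and "symmetric_pd C" and "x \<in> carrier_vec k"
  shows "0 \<le> x \<bullet> (C *\<^sub>v x)" "x \<bullet> (C *\<^sub>v x) = 0 \<Longrightarrow> x = 0\<^sub>v k"
  using assms unfolding symmetric_pd_def by (cases "x = 0\<^sub>v k"; force)+

section \<open>Diagonalizing a symmetric-definite pencil\<close>

text \<open>
  Throughout, \<open>Q S = A\<close> with \<open>A\<close> symmetric and \<open>Q\<close> symmetric positive definite, so \<open>S\<close> is self-adjoint
  for the inner product \<open>x \<bullet> Q y\<close>. Both obstructions to real diagonalizability, a
  nonreal eigenvalue and a Jordan chain, contradict this.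
\<close>

context
  fixes A Q S :: "real mat" and k :: nat
  assumes A: "A \<in> carrier_mat k k" "A\<^sup>T = A"
    and Q: "Q \<in> carrier_mat k k" "symmetric_pd Q"
    and S: "S \<in> carrier_mat k k" "Q * S = A"
begin

lemma pencil_Q_symmetric: "Q\<^sup>T = Q"
  using Q unfolding symmetric_pd_def by auto

lemma pencil_apply: "x \<in> carrier_vec k \<Longrightarrow> A *\<^sub>v x = Q *\<^sub>v (S *\<^sub>v x)"
  using Q S by (metis assoc_mult_mat_vec)

lemma pencil_self_adjoint:
  assumes "x \<in> carrier_vec k" "y \<in> carrier_vec k"
  shows "x \<bullet> (Q *\<^sub>v (S *\<^sub>v y)) = y \<bullet> (Q *\<^sub>v (S *\<^sub>v x))"
  using symmetric_form_swap[OF A assms] assms by (simp add: pencil_apply)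

text \<open>
  The hypotheses are the real and imaginary parts of an eigenvector equation
  \<open>S (x + i y) = (a + i b) (x + i y)\<close>. Comparing \<open>y \<bullet> Q S x\<close> with \<open>x \<bullet> Q S y\<close> gives
  \<open>b (x \<bullet> Q x + y \<bullet> Q y) = 0\<close>, and the bracket is positive.
\<close>

lemma pencil_no_rotation:
  assumes x: "x \<in> carrier_vec k" and y: "y \<in> carrier_vec k"
    and Sx: "S *\<^sub>v x = a \<cdot>\<^sub>v x - b \<cdot>\<^sub>v y" and Sy: "S *\<^sub>v y = b \<cdot>\<^sub>v x + a \<cdot>\<^sub>v y"
    and nz: "x \<noteq> 0\<^sub>v k \<or> y \<noteq> 0\<^sub>v k"
  shows "b = 0"
proof -
  have Qx: "Q *\<^sub>v x \<in> carrier_vec k" and Qy: "Q *\<^sub>v y \<in> carrier_vec k"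
    using x y Q by auto
  have "y \<bullet> (Q *\<^sub>v (S *\<^sub>v x)) = a * (y \<bullet> (Q *\<^sub>v x)) - b * (y \<bullet> (Q *\<^sub>v y))"
    unfolding Sx using x y Q Qx Qy
    by (simp add: mult_minus_distrib_mat_vec[OF Q(1)] mult_mat_vec[OF Q(1)]
        scalar_prod_minus_distrib[of _ k])
  moreover have "x \<bullet> (Q *\<^sub>v (S *\<^sub>v y)) = b * (x \<bullet> (Q *\<^sub>v x)) + a * (x \<bullet> (Q *\<^sub>v y))"
    unfolding Sy using x y Q Qx Qy
    by (simp add: mult_add_distrib_mat_vec[OF Q(1)] mult_mat_vec[OF Q(1)]
        scalar_prod_add_distrib[of _ k])
  ultimately have "b * (x \<bullet> (Q *\<^sub>v x) + y \<bullet> (Q *\<^sub>v y)) = 0"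
    using pencil_self_adjoint[OF x y] symmetric_form_swap[OF Q(1) pencil_Q_symmetric x y]
    by (simp add: algebra_simps)
  moreover have "x \<bullet> (Q *\<^sub>v x) + y \<bullet> (Q *\<^sub>v y) \<noteq> 0"
    using symmetric_pdD[OF Q x] symmetric_pdD[OF Q y] nz by argo
  ultimately show ?thesis by simp
qed

text \<open>
  Comparing \<open>x \<bullet> Q S y\<close> with \<open>y \<bullet> Q S x\<close> leaves \<open>c (x \<bullet> Q x) = 0\<close>: an eigenvector \<open>x\<close> cannot be
  followed by a generalized eigenvector \<open>y\<close>.
\<close>

lemma pencil_no_jordan_chain:
  assumes x: "x \<in> carrier_vec k" and y: "y \<in> carrier_vec k"
    and Sx: "S *\<^sub>v x = a \<cdot>\<^sub>v x" and Sy: "S *\<^sub>v y = a \<cdot>\<^sub>v y + c \<cdot>\<^sub>v x" and c: "c \<noteq> 0"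
  shows "x = 0\<^sub>v k"
proof -
  have Qx: "Q *\<^sub>v x \<in> carrier_vec k" and Qy: "Q *\<^sub>v y \<in> carrier_vec k"
    using x y Q by auto
  have "y \<bullet> (Q *\<^sub>v (S *\<^sub>v x)) = a * (y \<bullet> (Q *\<^sub>v x))"
    unfolding Sx using x y Q Qx Qy by (simp add: mult_mat_vec[OF Q(1)])
  moreover have "x \<bullet> (Q *\<^sub>v (S *\<^sub>v y)) = a * (x \<bullet> (Q *\<^sub>v y)) + c * (x \<bullet> (Q *\<^sub>v x))"
    unfolding Sy using x y Q Qx Qy
    by (simp add: mult_add_distrib_mat_vec[OF Q(1)] mult_mat_vec[OF Q(1)]
        scalar_prod_add_distrib[of _ k])
  ultimately have "c * (x \<bullet> (Q *\<^sub>v x)) = 0"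
    using pencil_self_adjoint[OF x y] symmetric_form_swap[OF Q(1) pencil_Q_symmetric x y] by simp
  with c symmetric_pdD(2)[OF Q x] show ?thesis by simp
qed

text \<open>
  Over the complex numbers the characteristic polynomial splits, and its roots have no imaginary part
  by \<open>pencil_no_rotation\<close>; so the factorization is already one over the reals.
\<close>

lemma pencil_char_poly_splits: "\<exists>as. char_poly S = (\<Prod>a\<leftarrow>as. [:- a, 1:])"
proof -
  let ?h = "complex_of_real"
  have hS: "map_mat ?h S \<in> carrier_mat k k" using S by simp
  obtain cs where cs: "char_poly (map_mat ?h S) = (\<Prod>a\<leftarrow>cs. [:- a, 1:])"
    using char_poly_factorized[OF hS] by blast
  have real: "Im c = 0" if "c \<in> set cs" for c
  proof -
    have "poly (\<Prod>a\<leftarrow>cs. [:- a, 1:]) c = 0"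
      using that by (induction cs) auto
    then have "eigenvalue (map_mat ?h S) c"
      using eigenvalue_root_char_poly[OF hS] cs by simp
    then obtain v where v: "v \<in> carrier_vec k" "v \<noteq> 0\<^sub>v k"
      and Sv: "map_mat ?h S *\<^sub>v v = c \<cdot>\<^sub>v v"
      unfolding eigenvalue_def eigenvector_def using S by auto
    let ?x = "map_vec Re v" and ?y = "map_vec Im v"
    have comp: "(\<Sum>j<k. ?h (S $$ (i, j)) * v $ j) = c * v $ i" if "i < k" for i
      using arg_cong[OF Sv, of "\<lambda>u. u $ i"] that v S
      by (simp add: scalar_prod_def lessThan_atLeast0)
    have Re: "(\<Sum>j<k. S $$ (i, j) * Re (v $ j)) = Re (c * v $ i)" if "i < k" for i
      using arg_cong[OF comp[OF that], of Re] by simp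
    have Im: "(\<Sum>j<k. S $$ (i, j) * Im (v $ j)) = Im (c * v $ i)" if "i < k" for i
      using arg_cong[OF comp[OF that], of Im] by simp
    show ?thesis
    proof (rule pencil_no_rotation)
      show "?x \<in> carrier_vec k" "?y \<in> carrier_vec k" using v by auto
      show "S *\<^sub>v ?x = Re c \<cdot>\<^sub>v ?x - Im c \<cdot>\<^sub>v ?y"
        using v S Re by (intro eq_vecI) (auto simp: scalar_prod_def lessThan_atLeast0)
      show "S *\<^sub>v ?y = Im c \<cdot>\<^sub>v ?x + Re c \<cdot>\<^sub>v ?y"
        using v S Im by (intro eq_vecI) (auto simp: scalar_prod_def lessThan_atLeast0)
      show "?x \<noteq> 0\<^sub>v k \<or> ?y \<noteq> 0\<^sub>v k"
      proof (rule ccontr)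
        assume "\<not> ?thesis"
        then have "Re (v $ i) = 0 \<and> Im (v $ i) = 0" if "i < k" for i
          using that v by (metis carrier_vecD index_map_vec(1) index_zero_vec(1))
        then have "v = 0\<^sub>v k" using v by (intro eq_vecI) (auto simp: complex_eq_iff)
        with v show False by simp
      qed
    qed
  qed
  interpret hp: map_poly_inj_idom_hom ?h ..
  have "map_poly ?h (char_poly S) = (\<Prod>a\<leftarrow>cs. [:- a, 1:])"
    using of_real_hom.char_poly_hom[OF S(1), where 'a = complex] cs by simp
  also have "\<dots> = (\<Prod>a\<leftarrow>map Re cs. map_poly ?h [:- a, 1:])"
    using real by (induction cs) (auto simp: complex_eq_iff map_poly_pCons)
  also have "\<dots> = map_poly ?h (\<Prod>a\<leftarrow>map Re cs. [:- a, 1:])"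
    by (simp add: hp.hom_prod_list o_def)
  finally have "char_poly S = (\<Prod>a\<leftarrow>map Re cs. [:- a, 1:])"
    by (simp add: poly_eq_iff coeff_map_poly)
  then show ?thesis by blast
qed

end

text \<open>
  Locates the nonzero entries of a Jordan matrix without reference to block boundaries: what matters
  below is that a nonzero superdiagonal entry joins two equal diagonal entries.
\<close>

lemma jordan_matrix_entries:
  assumes "i < sum_list (map fst n_as)" "j < sum_list (map fst n_as)"
    and "jordan_matrix n_as $$ (i, j) \<noteq> 0"
  shows "i = j \<or> (Suc i = j \<and> jordan_matrix n_as $$ (i, i) = jordan_matrix n_as $$ (j, j))"
  using assms
proof (induction n_as arbitrary: i j)
  case Nil
  then show ?case by simp
next
  case (Cons na n_as)
  obtain n a where na: "na = (n, a)" by (cases na)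
  show ?case
  proof (cases "i < n \<or> j < n")
    case True
    with Cons.prems show ?thesis
      unfolding na jordan_matrix_Cons by (auto split: if_splits)
  next
    case False
    then have "jordan_matrix n_as $$ (i - n, j - n) \<noteq> 0" "i - n < sum_list (map fst n_as)"
      "j - n < sum_list (map fst n_as)"
      using Cons.prems unfolding na jordan_matrix_Cons by (auto split: if_splits)
    from Cons.IH[OF this(2,3,1)] False Cons.prems show ?thesis
      unfolding na jordan_matrix_Cons by (auto split: if_splits)
  qed
qed

text \<open>
  The characteristic polynomial splits, so \<open>S\<close> has a real Jordan normal form \<open>J\<close>. If \<open>J\<close> had a nonzero
  superdiagonal entry, the first one would exhibit an eigenvector (a column of the invertible
  transformation matrix) followed by a generalized eigenvector.
\<close>

lemma symmetric_pencil_diagonalizable: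
  fixes A Q S :: "real mat"
  assumes A: "A \<in> carrier_mat k k" "A\<^sup>T = A"
    and Q: "Q \<in> carrier_mat k k" "symmetric_pd Q"
    and S: "S \<in> carrier_mat k k" "Q * S = A"
  obtains P P' D where "similar_mat_wit S D P P'" and "diagonal_mat D"
proof -
  obtain n_as where "jordan_nf S n_as"
    using pencil_char_poly_splits[OF assms] jordan_nf_exists[OF S(1)] by blast
  then obtain P P' where wit: "similar_mat_wit S (jordan_matrix n_as) P P'"
    unfolding jordan_nf_def similar_mat_def by blast
  define J where "J = jordan_matrix n_as"
  note w = similar_mat_witD2[OF S(1) wit[folded J_def]]
  have k: "sum_list (map fst n_as) = k"
    using w(5) jordan_matrix_carrier[of n_as] unfolding J_def carrier_mat_def by simp
  note entries = jordan_matrix_entries[of _ n_as, folded J_def, unfolded k]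
  have SP: "S * P = P * J"
  proof -
    have "S * P = P * J * P' * P" using w by simp
    also have "\<dots> = P * J * (P' * P)" using w by (intro assoc_mult_mat[of _ k k _ k _ k]) auto
    finally show ?thesis using w by simp
  qed
  have Pcol: "P *\<^sub>v unit_vec k j = col P j" if "j < k" for j
    using that w by (intro eq_vecI) auto
  have Scol: "S *\<^sub>v col P j = P *\<^sub>v col J j" if "j < k" for j
    using arg_cong[OF SP, of "\<lambda>C. col C j"] that w(5,6) S(1)
    by (metis col_mult2)
  have super: "J $$ (i, Suc i) = 0" if "Suc i < k" for i
    using that
  proof (induction i rule: less_induct)
    case (less i)
    show ?case
    proof (rule ccontr)
      assume c: "J $$ (i, Suc i) \<noteq> 0"
      let ?a = "J $$ (i, i)"
      have a: "J $$ (Suc i, Suc i) = ?a"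
        using entries[of i "Suc i"] less.prems c by auto
      \<comment> \<open>As the superdiagonal entries before \<open>i\<close> vanish, column \<open>i\<close> has only its diagonal entry.\<close>
      have "J $$ (l, i) = 0" if "l < k" "l \<noteq> i" for l
        using entries[of l i] that less.prems less.IH[of l] by auto
      then have c1: "col J i = ?a \<cdot>\<^sub>v unit_vec k i"
        using w(5) less.prems by (intro eq_vecI) auto
      have "J $$ (l, Suc i) = 0" if "l < k" "l \<noteq> i" "l \<noteq> Suc i" for l
        using entries[of l "Suc i"] that less.prems by auto
      then have c2: "col J (Suc i) = ?a \<cdot>\<^sub>v unit_vec k (Suc i) + J $$ (i, Suc i) \<cdot>\<^sub>v unit_vec k i"
        using w(5) less.prems a by (intro eq_vecI) auto
      have "col P i = 0\<^sub>v k"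
      proof (rule pencil_no_jordan_chain[OF assms])
        show "col P i \<in> carrier_vec k" "col P (Suc i) \<in> carrier_vec k"
          using w(6) less.prems by auto
        show "S *\<^sub>v col P i = ?a \<cdot>\<^sub>v col P i"
          using Scol[of i] less.prems w(6) Pcol[of i] by (simp add: c1 mult_mat_vec)
        show "S *\<^sub>v col P (Suc i) = ?a \<cdot>\<^sub>v col P (Suc i) + J $$ (i, Suc i) \<cdot>\<^sub>v col P i"
          using Scol[of "Suc i"] less.prems w(6) Pcol[of i] Pcol[of "Suc i"]
          by (simp add: c2 mult_mat_vec[OF w(6)] mult_add_distrib_mat_vec[OF w(6)])
      qed (fact c)
      then have "P' *\<^sub>v (P *\<^sub>v unit_vec k i) = 0\<^sub>v k"
        using Pcol[of i] less.prems w(7) by (auto simp: scalar_prod_def)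
      moreover have "P' *\<^sub>v (P *\<^sub>v unit_vec k i) = unit_vec k i"
        using w(2,6,7) by (metis assoc_mult_mat_vec one_mult_mat_vec unit_vec_carrier)
      ultimately show False
        using less.prems by (metis index_unit_vec(1) index_zero_vec(1) Suc_lessD zero_neq_one)
    qed
  qed
  have "diagonal_mat J"
    unfolding diagonal_mat_def using entries super w(5) by auto
  with wit show thesis
    using that unfolding J_def by blast
qed

section \<open>The span of the positive eigenvectors\<close>

text \<open>
  A new linear factor raises the order at its root by one and changes no other order; the root set may
  grow, but orders vanish at points that are not roots.
\<close>

lemma sum_order_linear_factors:
  fixes as :: "real list"
  defines "p \<equiv> \<Prod>a\<leftarrow>as. [:- a, 1:]"
  shows "(\<Sum>a \<in> {a. poly p a = 0 \<and> 0 < a}. order a p) = length (filter (\<lambda>a. 0 < a) as)"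
  unfolding p_def
proof (induction as)
  case Nil
  then show ?case by simp
next
  case (Cons b as)
  let ?p = "\<Prod>a\<leftarrow>as. [:- a, 1:]"
  let ?R = "\<lambda>p :: real poly. {a. poly p a = 0 \<and> 0 < a}"
  have nz: "?p \<noteq> 0" by (auto simp: prod_list_zero_iff)
  then have fin: "finite (?R ?p)"
    by (auto intro: finite_subset[OF _ poly_roots_finite[OF nz]])
  have ord: "order a ([:- b, 1:] * ?p) = (if a = b then 1 else 0) + order a ?p" for a
  proof -
    have "order a ([:- b, 1:] * ?p) = order a [:- b, 1:] + order a ?p"
      by (rule order_mult) (use nz in \<open>simp del: mult_pCons_left\<close>)
    moreover have "order a [:- b, 1:] = (if a = b then 1 else 0)"
      using order_power_n_n[of b 1] by (auto simp: order_0I)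
    ultimately show ?thesis
      by (simp only:)
  qed
  have "(\<Sum>a \<in> ?R ([:- b, 1:] * ?p). order a ([:- b, 1:] * ?p))
      = (\<Sum>a \<in> insert b (?R ?p) \<inter> {0<..}. (if a = b then 1 else 0) + order a ?p)"
    unfolding ord by (rule sum.cong) auto
  also have "\<dots> = (if 0 < b then 1 else 0) + (\<Sum>a \<in> insert b (?R ?p) \<inter> {0<..}. order a ?p)"
    using fin by (simp add: sum.distrib)
  also have "(\<Sum>a \<in> insert b (?R ?p) \<inter> {0<..}. order a ?p) = (\<Sum>a \<in> ?R ?p. order a ?p)"
    using fin order_0I[of ?p] by (intro sum.mono_neutral_right) force+
  finally show ?case
    using Cons.IH by simp
qed

text \<open>
  Algebraic multiplicities only depend on the characteristic polynomial, which can be read off from the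
  diagonal of \<open>D\<close>.
\<close>

lemma num_pos_eigenvalues_similar_diagonal:
  assumes "similar_mat_wit S D P P'" and "diagonal_mat D" and "S \<in> carrier_mat k k"
  shows "num_pos_eigenvalues S = card {i. i < k \<and> 0 < D $$ (i, i)}"
proof -
  have D: "D \<in> carrier_mat k k"
    using similar_mat_witD2[OF assms(3,1)] by simp
  have "char_poly S = char_poly D"
    using assms(1) char_poly_similar unfolding similar_mat_def by blast
  also have "\<dots> = (\<Prod>a\<leftarrow>diag_mat D. [:- a, 1:])"
    using assms(2) D by (intro char_poly_upper_triangular[of _ k])
      (auto simp: diagonal_mat_def upper_triangular_def)
  finally have "num_pos_eigenvalues S = length (filter (\<lambda>a. 0 < a) (diag_mat D))"
    unfolding num_pos_eigenvalues_def eigenvalue_root_char_poly[OF assms(3)]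
    using sum_order_linear_factors[of "diag_mat D"] by simp
  also have "\<dots> = card {i. i < k \<and> 0 < D $$ (i, i)}"
    using D by (simp add: diag_mat_def length_filter_conv_card cong: conj_cong)
  finally show ?thesis .
qed

text \<open>
  In the eigenbasis \<open>P\<close>, the eigenvector columns of \<open>T\<close> have coordinates \<open>K = P' T\<close> with
  \<open>D K = K L\<close>. As \<open>L\<close> is positive, the rows of \<open>K\<close> outside the \<open>q\<close> positive positions of \<open>D\<close> vanish,
  so independence of the columns makes the remaining \<open>q \<times> q\<close> block \<open>K'\<close> invertible. Every vector with
  coordinates supported in the positive positions is therefore attained.
\<close>

lemma positive_eigenvectors_span:
  fixes S D P P' T L :: "real mat"
  assumes wit: "similar_mat_wit S D P P'" and D: "diagonal_mat D" and S: "S \<in> carrier_mat k k"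
    and q: "q = card {i. i < k \<and> 0 < D $$ (i, i)}"
    and T: "T \<in> carrier_mat k q" and L: "L \<in> carrier_mat q q" "diagonal_mat L"
    and pos: "\<And>j. j < q \<Longrightarrow> 0 < L $$ (j, j)"
    and ST: "S * T = T * L" and indpt: "lin_indpt_cols T"
    and x: "x \<in> carrier_vec k"
    and x0: "\<And>i. i < k \<Longrightarrow> \<not> 0 < D $$ (i, i) \<Longrightarrow> (P' *\<^sub>v x) $ i = 0"
  shows "\<exists>z \<in> carrier_vec q. x = T *\<^sub>v z"
proof -
  note w = similar_mat_witD2[OF S wit]
  define K where "K = P' * T"
  have K: "K \<in> carrier_mat k q"
    using w T by (simp add: K_def)
  have TK: "T = P * K"
    using w(1,6,7) T unfolding K_def by (simp flip: assoc_mult_mat)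
  have "D * K = K * L"
  proof -
    have "D * K = P' * P * D * P' * T"
      using w(2,5,7) T by (simp add: K_def)
    also have "P' * P * D * P' = P' * (P * D * P')"
      using w(5,6,7) by (simp add: assoc_mult_mat[of _ k k _ k _ k])
    also have "\<dots> * T = P' * (S * T)"
      unfolding w(3)[symmetric] using w(7) S T by simp
    also have "\<dots> = K * L"
      unfolding ST K_def using w(7) T L by simp
    finally show ?thesis .
  qed
  moreover have "(D * K) $$ (i, j) = D $$ (i, i) * K $$ (i, j)" if "i < k" "j < q" for i j
  proof -
    have "(D * K) $$ (i, j) = (\<Sum>l<k. D $$ (i, l) * K $$ (l, j))"
      using that w(5) K by (simp add: scalar_prod_def lessThan_atLeast0)
    also have "\<dots> = (\<Sum>l<k. if l = i then D $$ (i, i) * K $$ (i, j) else 0)"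
      using D that w(5) unfolding diagonal_mat_def by (intro sum.cong) auto
    finally show ?thesis using that by simp
  qed
  moreover have "(K * L) $$ (i, j) = K $$ (i, j) * L $$ (j, j)" if "i < k" "j < q" for i j
  proof -
    have "(K * L) $$ (i, j) = (\<Sum>l<q. K $$ (i, l) * L $$ (l, j))"
      using that L K by (simp add: scalar_prod_def lessThan_atLeast0)
    also have "\<dots> = (\<Sum>l<q. if l = j then K $$ (i, j) * L $$ (j, j) else 0)"
      using L that unfolding diagonal_mat_def by (intro sum.cong) auto
    finally show ?thesis using that by simp
  qed
  ultimately have eig: "D $$ (i, i) * K $$ (i, j) = K $$ (i, j) * L $$ (j, j)"
    if "i < k" "j < q" for i j
    using that by metis
  have K0: "K $$ (i, j) = 0" if "i < k" "j < q" "\<not> 0 < D $$ (i, i)" for i j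
    using eig[OF that(1,2)] pos[OF that(2)] that(3) by (auto simp: mult.commute)
  let ?Pos = "{i. i < k \<and> 0 < D $$ (i, i)}"
  obtain f where f: "bij_betw f {0..<q} ?Pos"
    using ex_bij_betw_nat_finite[of ?Pos] q by auto
  have fk: "f a < k" if "a < q" for a
    using bij_betwE[OF f] that by auto
  have fex: "\<exists>a<q. i = f a" if "i < k" "0 < D $$ (i, i)" for i
    using f that unfolding bij_betw_def by (metis (mono_tags, lifting) atLeastLessThan_iff imageE mem_Collect_eq)
  \<comment> \<open>\<open>K'\<close> keeps the rows of \<open>K\<close> in the positive positions, enumerated by \<open>f\<close>.\<close>
  define K' where "K' = mat q q (\<lambda>(a, b). K $$ (f a, b))"
  have K': "K' \<in> carrier_mat q q" by (simp add: K'_def)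
  have rowK': "row K' a = row K (f a)" if "a < q" for a
    using that K fk unfolding K'_def by (intro eq_vecI) auto
  have Kmult: "K *\<^sub>v v = y"
    if "K' *\<^sub>v v = vec q (\<lambda>a. y $ f a)" and "v \<in> carrier_vec q" and y: "y \<in> carrier_vec k"
      and y0: "\<And>i. i < k \<Longrightarrow> \<not> 0 < D $$ (i, i) \<Longrightarrow> y $ i = 0" for v y
  proof (intro eq_vecI)
    fix i assume "i < dim_vec y"
    then have i: "i < k" using y by simp
    show "(K *\<^sub>v v) $ i = y $ i"
    proof (cases "0 < D $$ (i, i)")
      case True
      then obtain a where a: "a < q" "i = f a" using fex i by blast
      have "(K' *\<^sub>v v) $ a = y $ f a" using that(1) a by simp
      then show ?thesis using a i K K' rowK' by simp
    next
      case False
      then show ?thesis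
        using i K0 y0 K that(2) by (simp add: scalar_prod_def)
    qed
  qed (use K y in auto)
  have "det K' \<noteq> 0"
  proof
    assume "det K' = 0"
    then obtain v where v: "v \<in> carrier_vec q" "v \<noteq> 0\<^sub>v q" "K' *\<^sub>v v = 0\<^sub>v q"
      using det_0_iff_vec_prod_zero_field[OF K'] by blast
    have "K *\<^sub>v v = 0\<^sub>v k"
      using v fk by (intro Kmult) (auto intro!: eq_vecI)
    then have "T *\<^sub>v v = 0\<^sub>v k"
      using TK w(6) K v by (auto simp: scalar_prod_def)
    with lin_indpt_cols_injective[OF T indpt v(1)] v(2) show False by blast
  qed
  note inv = det_nonzero_inv_mat[OF K' this]
  define z where "z = inv_mat K' *\<^sub>v vec q (\<lambda>a. (P' *\<^sub>v x) $ f a)"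
  have z: "z \<in> carrier_vec q" using inv by (simp add: z_def)
  have "K' *\<^sub>v z = K' * inv_mat K' *\<^sub>v vec q (\<lambda>a. (P' *\<^sub>v x) $ f a)"
    unfolding z_def using K' inv(1) by (simp add: assoc_mult_mat_vec[of _ q q _ q])
  then have "K *\<^sub>v z = P' *\<^sub>v x"
    using inv(2) w(7) x x0 z by (intro Kmult) auto
  then have "T *\<^sub>v z = P *\<^sub>v (P' *\<^sub>v x)"
    unfolding TK using w(6) K z by simp
  also have "\<dots> = x"
    using w(1,6,7) x by (simp flip: assoc_mult_mat_vec)
  finally show ?thesis using z by auto
qed

section \<open>Matrices with three column blocks\<close>

lemma col_append_three:
  assumes "C \<in> carrier_mat N a" and "D \<in> carrier_mat N b" and "E \<in> carrier_mat N c"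
  shows "append_three C D E \<in> carrier_mat N (a + b + c)"
    and "i < a \<Longrightarrow> col (append_three C D E) i = col C i"
    and "i < b \<Longrightarrow> col (append_three C D E) (a + i) = col D i"
    and "i < c \<Longrightarrow> col (append_three C D E) (a + b + i) = col E i"
proof -
  let ?W = "append_three C D E"
  show W: "?W \<in> carrier_mat N (a + b + c)"
    using assms unfolding append_three_def carrier_mat_def by auto
  have entry: "?W $$ (l, j) = (cols C @ cols D @ cols E) ! j $ l" if "l < N" "j < a + b + c" for l j
    using that assms unfolding append_three_def by (auto simp: mat_of_cols_index)
  show "i < a \<Longrightarrow> col ?W i = col C i" "i < b \<Longrightarrow> col ?W (a + i) = col D i"
    "i < c \<Longrightarrow> col ?W (a + b + i) = col E i"
    using W entry assms by (auto intro!: eq_vecI simp: nth_append)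
qed

text \<open>
  If the square matrix \<open>W = [C, D, E]\<close> is invertible, so is its transpose, and \<open>W\<^sup>T x\<close> consists of the
  three given products. This is how vectors are tested against \<open>U\<close> and \<open>V\<close>.
\<close>

lemma append_three_separates:
  assumes "C \<in> carrier_mat N a" and "D \<in> carrier_mat N b" and "E \<in> carrier_mat N c"
    and "det (append_three C D E) \<noteq> 0" and "a + b + c = N"
    and x: "x \<in> carrier_vec N"
    and "C\<^sup>T *\<^sub>v x = 0\<^sub>v a" "D\<^sup>T *\<^sub>v x = 0\<^sub>v b" "E\<^sup>T *\<^sub>v x = 0\<^sub>v c"
  shows "x = 0\<^sub>v N"
proof -
  let ?W = "append_three C D E"
  note W = col_append_three[OF assms(1-3)]
  have C: "col C i \<bullet> x = 0" if "i < a" for i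
    using arg_cong[OF assms(7), of "\<lambda>v. v $ i"] that assms(1) by simp
  have D: "col D i \<bullet> x = 0" if "i < b" for i
    using arg_cong[OF assms(8), of "\<lambda>v. v $ i"] that assms(2) by simp
  have E: "col E i \<bullet> x = 0" if "i < c" for i
    using arg_cong[OF assms(9), of "\<lambda>v. v $ i"] that assms(3) by simp
  have "col ?W i \<bullet> x = 0" if "i < N" for i
  proof -
    consider "i < a" | j where "i = a + j" "j < b" | j where "i = a + b + j" "j < c"
      using \<open>i < N\<close> assms(5) by (metis add.assoc nat_add_left_cancel_less not_less le_Suc_ex)
    then show ?thesis
      using C D E W by cases auto
  qed
  then have "?W\<^sup>T *\<^sub>v x = 0\<^sub>v N"
    using W(1) assms(5) by (intro eq_vecI) auto
  moreover have "det ?W\<^sup>T \<noteq> 0" "?W\<^sup>T \<in> carrier_mat N N"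
    using W(1) assms(4,5) by (auto simp: det_transpose)
  ultimately show ?thesis
    using det_0_iff_vec_prod_zero_field x by blast
qed

lemma column_orthogonal_append_three:
  assumes "C \<in> carrier_mat N a" and "D \<in> carrier_mat N b" and "E \<in> carrier_mat N c"
    and "column_orthogonal (append_three C D E)"
  shows "C\<^sup>T * C = 1\<^sub>m a" "D\<^sup>T * D = 1\<^sub>m b" "E\<^sup>T * E = 1\<^sub>m c"
    and "C\<^sup>T * D = 0\<^sub>m a b" "C\<^sup>T * E = 0\<^sub>m a c" "D\<^sup>T * C = 0\<^sub>m b a"
    and "D\<^sup>T * E = 0\<^sub>m b c" "E\<^sup>T * C = 0\<^sub>m c a" "E\<^sup>T * D = 0\<^sub>m c b"
proof -
  let ?W = "append_three C D E"
  note W = col_append_three[OF assms(1-3)]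
  have ip: "col ?W i \<bullet> col ?W j = (if i = j then 1 else 0)"
    if "i < a + b + c" "j < a + b + c" for i j
    using arg_cong[OF assms(4)[unfolded column_orthogonal_def], of "\<lambda>M. M $$ (i, j)"] that W(1)
    by simp
  show "C\<^sup>T * C = 1\<^sub>m a"
    using ip[of i j for i j] assms(1) by (intro eq_matI) (auto simp flip: W(2))
  show "D\<^sup>T * D = 1\<^sub>m b"
    using ip[of "a + i" "a + j" for i j] assms(2) by (intro eq_matI) (auto simp flip: W(3))
  show "E\<^sup>T * E = 1\<^sub>m c"
    using ip[of "a + b + i" "a + b + j" for i j] assms(3) by (intro eq_matI) (auto simp flip: W(4))
  show CD: "C\<^sup>T * D = 0\<^sub>m a b"
    using ip[of i "a + j" for i j] assms(1,2)
    by (intro eq_matI) (auto simp flip: W(2,3))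
  show CE: "C\<^sup>T * E = 0\<^sub>m a c"
    using ip[of i "a + b + j" for i j] assms(1,3)
    by (intro eq_matI) (auto simp flip: W(2,4))
  show DE: "D\<^sup>T * E = 0\<^sub>m b c"
    using ip[of "a + i" "a + b + j" for i j] assms(2,3)
    by (intro eq_matI) (auto simp flip: W(3,4))
  show "D\<^sup>T * C = 0\<^sub>m b a"
    using arg_cong[OF CD, of transpose_mat] assms by (simp add: transpose_mult[of _ a N])
  show "E\<^sup>T * C = 0\<^sub>m c a"
    using arg_cong[OF CE, of transpose_mat] assms by (simp add: transpose_mult[of _ a N])
  show "E\<^sup>T * D = 0\<^sub>m c b"
    using arg_cong[OF DE, of transpose_mat] assms by (simp add: transpose_mult[of _ b N])
qed

section \<open>Exponentials of diagonal matrices\<close>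

lemma pow_diagonal_mat:
  fixes C :: "real mat"
  assumes C: "C \<in> carrier_mat k k" "diagonal_mat C"
  shows "C ^\<^sub>m l = mat k k (\<lambda>(i, j). if i = j then C $$ (i, i) ^ l else 0)"
proof (induction l)
  case 0
  show ?case by (rule eq_matI) (use C(1) in simp_all)
next
  case (Suc l)
  show ?case
  proof (rule eq_matI)
    fix i j assume "i < dim_row (mat k k (\<lambda>(i, j). if i = j then C $$ (i, i) ^ Suc l else 0))"
      "j < dim_col (mat k k (\<lambda>(i, j). if i = j then C $$ (i, i) ^ Suc l else 0))"
    then have ij: "i < k" "j < k" by auto
    have "(C ^\<^sub>m Suc l) $$ (i, j) = (\<Sum>a<k. (if i = a then C $$ (i, i) ^ l else 0) * C $$ (a, j))"
      using ij C by (simp add: Suc scalar_prod_def lessThan_atLeast0)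
    also have "\<dots> = (\<Sum>a<k. if i = a then C $$ (i, i) ^ l * C $$ (i, j) else 0)"
      by (intro sum.cong) auto
    also have "\<dots> = (if i = j then C $$ (i, i) ^ Suc l else 0)"
      using ij C unfolding diagonal_mat_def by auto
    finally show "(C ^\<^sub>m Suc l) $$ (i, j) =
        mat k k (\<lambda>(i, j). if i = j then C $$ (i, i) ^ Suc l else 0) $$ (i, j)"
      using ij by simp
  qed (use C(1) in simp_all)
qed

lemma mat_exp_diagonal:
  assumes C: "C \<in> carrier_mat k k" "diagonal_mat C"
  shows "mat_exp C = mat k k (\<lambda>(i, j). if i = j then exp (C $$ (i, i)) else 0)"
proof (rule eq_matI)
  fix i j assume "i < dim_row (mat k k (\<lambda>(i, j). if i = j then exp (C $$ (i, i)) else 0))"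
      "j < dim_col (mat k k (\<lambda>(i, j). if i = j then exp (C $$ (i, i)) else 0))"
  then have ij: "i < k" "j < k" by auto
  have "(\<Sum>l. x ^ l / fact l) = exp x" for x :: real
    by (simp add: exp_def divide_inverse mult.commute)
  then show "mat_exp C $$ (i, j) = mat k k (\<lambda>(i, j). if i = j then exp (C $$ (i, i)) else 0) $$ (i, j)"
    using ij C by (simp add: mat_exp_def pow_diagonal_mat[OF C])
qed (use C(1) in \<open>simp_all add: mat_exp_def\<close>)

lemma inv_mat_diagonal:
  assumes L: "L \<in> carrier_mat q q" "diagonal_mat L" and nz: "\<And>i. i < q \<Longrightarrow> L $$ (i, i) \<noteq> 0"
  shows "inv_mat L = mat q q (\<lambda>(i, j). if i = j then 1 / L $$ (i, i) else 0)"
proof (rule inv_mat_eqI[OF L(1)])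
  let ?D = "mat q q (\<lambda>(i, j). if i = j then 1 / L $$ (i, i) else 0)"
  show "L * ?D = 1\<^sub>m q"
  proof (rule eq_matI)
    fix i j assume "i < dim_row (1\<^sub>m q)" "j < dim_col (1\<^sub>m q)"
    then have ij: "i < q" "j < q" by auto
    have "(L * ?D) $$ (i, j) = (\<Sum>a<q. L $$ (i, a) * (if a = j then 1 / L $$ (a, a) else 0))"
      using ij L by (simp add: scalar_prod_def lessThan_atLeast0)
    also have "\<dots> = (\<Sum>a<q. if a = j then L $$ (i, j) / L $$ (j, j) else 0)"
      by (intro sum.cong) auto
    also have "\<dots> = 1\<^sub>m q $$ (i, j)"
      using ij L nz unfolding diagonal_mat_def by auto
    finally show "(L * ?D) $$ (i, j) = 1\<^sub>m q $$ (i, j)" .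
  qed (use L(1) in simp_all)
qed simp

text \<open>
  The factor \<open>exp (- \<Lambda>\<^sup>-\<^sup>1 y)\<close> of the explicit solution acts on each coordinate by a scalar exponential.
\<close>

lemma mat_exp_decay_mult_vec:
  assumes L: "L \<in> carrier_mat q q" "diagonal_mat L" and nz: "\<And>i. i < q \<Longrightarrow> L $$ (i, i) \<noteq> 0"
    and z: "z \<in> carrier_vec q"
  shows "mat_exp (- (y \<cdot>\<^sub>m inv_mat L)) *\<^sub>v z = vec q (\<lambda>i. exp (- (1 / L $$ (i, i)) * y) * z $ i)"
proof -
  let ?C = "- (y \<cdot>\<^sub>m inv_mat L)"
  have inv: "inv_mat L = mat q q (\<lambda>(i, j). if i = j then 1 / L $$ (i, i) else 0)"
    by (rule inv_mat_diagonal[OF L]) (rule nz)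
  have C: "?C \<in> carrier_mat q q" "diagonal_mat ?C"
    unfolding inv by (auto simp: diagonal_mat_def)
  have E: "mat_exp ?C \<in> carrier_mat q q" "diagonal_mat (mat_exp ?C)"
    unfolding mat_exp_diagonal[OF C] by (auto simp: diagonal_mat_def)
  show ?thesis
  proof (rule eq_vecI)
    fix i assume "i < dim_vec (vec q (\<lambda>i. exp (- (1 / L $$ (i, i)) * y) * z $ i))"
    then have i: "i < q" by simp
    have "(mat_exp ?C *\<^sub>v z) $ i = exp (?C $$ (i, i)) * z $ i"
      using diagonal_mult_vec_index[OF E z i] i by (simp add: mat_exp_diagonal[OF C])
    then show "(mat_exp ?C *\<^sub>v z) $ i = vec q (\<lambda>i. exp (- (1 / L $$ (i, i)) * y) * z $ i) $ i"
      using i by (simp add: inv)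
  qed (use E(1) in simp_all)
qed

section \<open>Componentwise calculus\<close>

text \<open>
  The function \<open>w\<close> is known to take values of the right dimension only on \<open>[0, \<infinity>)\<close>. Elsewhere
  \<open>C *\<^sub>v w s\<close> need not be the expected linear combination of components, so here and for limits the
  components are replaced only on \<open>[0, \<infinity>)\<close>.
\<close>

lemma has_derivative_vec_mult_mat:
  assumes C: "C \<in> carrier_mat n d" and w: "\<And>s. 0 \<le> s \<Longrightarrow> w s \<in> carrier_vec d"
    and d: "has_derivative_vec d w w' (at y within {0..})" and y: "0 \<le> y"
  shows "has_derivative_vec n (\<lambda>s. C *\<^sub>v w s) (C *\<^sub>v w') (at y within {0..})"
  unfolding has_derivative_vec_def
proof (intro conjI allI impI)
  have w': "w' \<in> carrier_vec d"
    and dj: "\<And>j. j < d \<Longrightarrow> ((\<lambda>s. w s $ j) has_real_derivative w' $ j) (at y within {0..})"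
    using d unfolding has_derivative_vec_def by auto
  show "C *\<^sub>v w' \<in> carrier_vec n" using C w' by simp
  fix i assume i: "i < n"
  have "((\<lambda>s. \<Sum>j<d. C $$ (i, j) * w s $ j) has_real_derivative (\<Sum>j<d. C $$ (i, j) * w' $ j))
      (at y within {0..})"
    using dj by (intro DERIV_sum DERIV_cmult) auto
  then show "((\<lambda>s. (C *\<^sub>v w s) $ i) has_real_derivative (C *\<^sub>v w') $ i) (at y within {0..})"
    unfolding index_mult_mat_vec_sum[OF C w' i]
    by (rule has_field_derivative_transform_within[where d = 1])
      (use y in \<open>simp_all add: index_mult_mat_vec_sum[OF C w i]\<close>)
qed

lemma tendsto_vec_mult_mat:
  assumes C: "C \<in> carrier_mat n d" and w: "\<And>s. 0 \<le> s \<Longrightarrow> w s \<in> carrier_vec d"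
    and lim: "tendsto_vec d w (0\<^sub>v d) at_top"
  shows "tendsto_vec n (\<lambda>s. C *\<^sub>v w s) (0\<^sub>v n) at_top"
  unfolding tendsto_vec_def
proof (intro conjI allI impI)
  fix i assume i: "i < n"
  have "((\<lambda>s. \<Sum>j<d. C $$ (i, j) * w s $ j) \<longlongrightarrow> (\<Sum>j<d. C $$ (i, j) * 0)) at_top"
    using lim unfolding tendsto_vec_def by (intro tendsto_intros) auto
  moreover have "\<forall>\<^sub>F s in at_top. (\<Sum>j<d. C $$ (i, j) * w s $ j) = (C *\<^sub>v w s) $ i"
    by (rule eventually_mono[OF eventually_ge_at_top[of 0]])
      (rule index_mult_mat_vec_sum[OF C w i, symmetric])
  ultimately have "((\<lambda>s. (C *\<^sub>v w s) $ i) \<longlongrightarrow> (\<Sum>j<d. C $$ (i, j) * 0)) at_top"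
    by (rule Lim_transform_eventually)
  then show "((\<lambda>s. (C *\<^sub>v w s) $ i) \<longlongrightarrow> 0\<^sub>v n $ i) at_top"
    using i by simp
qed simp

text \<open>
  Derivatives within \<open>[0, \<infinity>)\<close> are unique, also the one-sided one at \<open>0\<close>. This transfers the linear
  constraints satisfied by a solution to its derivative.
\<close>

lemma has_real_derivative_zero_function:
  assumes "(f has_real_derivative c) (at y within {0..})" and "\<And>s. 0 \<le> s \<Longrightarrow> f s = 0" and "0 \<le> y"
  shows "c = 0"
proof -
  have "((\<lambda>_. 0) has_real_derivative c) (at y within {0..})"
    by (rule has_field_derivative_transform_within[OF assms(1), where d = 1]) (use assms in auto)
  moreover have "((\<lambda>_. 0) has_real_derivative 0) (at y within {0..})"
    by simp
  ultimately have "((\<lambda>_. 0) has_vector_derivative c) (at y within cbox 0 (y + 1))"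
    "((\<lambda>_. 0) has_vector_derivative 0) (at y within cbox 0 (y + 1))"
    unfolding has_real_derivative_iff_has_vector_derivative
    by (auto intro: has_vector_derivative_within_subset)
  then show ?thesis
    by (rule vector_derivative_unique_within_closed_interval[rotated 2]) (use assms(3) in auto)
qed

lemma has_integral_vec_mult_mat:
  assumes C: "C \<in> carrier_mat n d" and f: "\<And>s. f s \<in> carrier_vec d"
    and int: "has_integral_vec d f I S"
  shows "has_integral_vec n (\<lambda>s. C *\<^sub>v f s) (C *\<^sub>v I) S"
  unfolding has_integral_vec_def
proof (intro conjI allI impI)
  have I: "I \<in> carrier_vec d" using int by (simp add: has_integral_vec_def)
  show "C *\<^sub>v I \<in> carrier_vec n" using C I by simp
  fix i assume i: "i < n"
  show "((\<lambda>s. (C *\<^sub>v f s) $ i) has_integral (C *\<^sub>v I) $ i) S"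
    unfolding index_mult_mat_vec_sum[OF C f i] index_mult_mat_vec_sum[OF C I i]
    using int unfolding has_integral_vec_def
    by (intro has_integral_sum has_integral_mult_right) auto
qed

lemma decaying_solution_diff:
  assumes A: "A \<in> carrier_mat N N" and Q: "Q \<in> carrier_mat N N"
    and u: "decaying_solution A Q u" and v: "decaying_solution A Q v"
  shows "decaying_solution A Q (\<lambda>y. u y - v y)"
  unfolding decaying_solution_def
proof (intro conjI allI impI)
  note A' = carrier_matD[OF A]
  note uD = u[unfolded decaying_solution_def A'] and vD = v[unfolded decaying_solution_def A']
  show "u y - v y \<in> carrier_vec (dim_col A)" if "0 \<le> y" for y
    using uD vD that A' by auto
  show "tendsto_vec (dim_col A) (\<lambda>y. u y - v y) (0\<^sub>v (dim_col A)) at_top"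
    unfolding tendsto_vec_def A'
  proof (intro conjI allI impI)
    fix i assume i: "i < N"
    have "((\<lambda>y. u y $ i - v y $ i) \<longlongrightarrow> 0 - 0) at_top"
      using uD vD i unfolding tendsto_vec_def by (intro tendsto_diff) auto
    moreover have "\<forall>\<^sub>F y in at_top. u y $ i - v y $ i = (u y - v y) $ i"
      using vD i by (intro eventually_mono[OF eventually_ge_at_top[of 0]]) auto
    ultimately have "((\<lambda>y. (u y - v y) $ i) \<longlongrightarrow> 0 - 0) at_top"
      by (rule Lim_transform_eventually)
    then show "((\<lambda>y. (u y - v y) $ i) \<longlongrightarrow> 0\<^sub>v N $ i) at_top"
      using i by simp
  qed simp
  fix y :: real assume y: "0 \<le> y"
  obtain u' where u': "has_derivative_vec N u u' (at y within {0..})" "A *\<^sub>v u' = - (Q *\<^sub>v u y)"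
    using uD y by blast
  obtain v' where v': "has_derivative_vec N v v' (at y within {0..})" "A *\<^sub>v v' = - (Q *\<^sub>v v y)"
    using vD y by blast
  have c: "u' \<in> carrier_vec N" "v' \<in> carrier_vec N" "u y \<in> carrier_vec N" "v y \<in> carrier_vec N"
    using u'(1) v'(1) uD vD y unfolding has_derivative_vec_def by auto
  have "has_derivative_vec N (\<lambda>y. u y - v y) (u' - v') (at y within {0..})"
    unfolding has_derivative_vec_def
  proof (intro conjI allI impI)
    show "u' - v' \<in> carrier_vec N" using c by simp
    fix i assume i: "i < N"
    have "((\<lambda>y. u y $ i - v y $ i) has_real_derivative u' $ i - v' $ i) (at y within {0..})"
      using u'(1) v'(1) i unfolding has_derivative_vec_def by (intro DERIV_diff) auto
    moreover have "u' $ i - v' $ i = (u' - v') $ i"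
      using c i by simp
    ultimately have "((\<lambda>y. u y $ i - v y $ i) has_real_derivative (u' - v') $ i) (at y within {0..})"
      by simp
    then show "((\<lambda>y. (u y - v y) $ i) has_real_derivative (u' - v') $ i) (at y within {0..})"
      by (rule has_field_derivative_transform_within[where d = 1]) (use i vD y in auto)
  qed
  moreover have "A *\<^sub>v (u' - v') = - (Q *\<^sub>v (u y - v y))"
    using A Q c u'(2) v'(2)
    by (simp add: mult_minus_distrib_mat_vec[of _ N N]) (auto intro!: eq_vecI)
  ultimately show "\<exists>w'. has_derivative_vec (dim_col A) (\<lambda>y. u y - v y) w' (at y within {0..}) \<and>
      A *\<^sub>v w' = - (Q *\<^sub>v (u y - v y))"
    unfolding A' by blast
qed

section \<open>Decay at infinity\<close>

lemma decaying_constant_is_zero: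
  fixes f :: "real \<Rightarrow> real"
  assumes "\<And>s. 0 \<le> s \<Longrightarrow> (f has_real_derivative 0) (at s within {0..})"
    and "(f \<longlongrightarrow> 0) at_top" and "0 \<le> y"
  shows "f y = 0"
proof -
  obtain c where c: "\<And>s. 0 \<le> s \<Longrightarrow> f s = c"
    using has_field_derivative_zero_constant[of "{0..}" f] assms(1) by auto
  have "\<forall>\<^sub>F s in at_top. f s = c"
    using c by (rule eventually_mono[OF eventually_ge_at_top[of 0]])
  then have "((\<lambda>_ :: real. c) \<longlongrightarrow> 0) at_top"
    using assms(2) by (simp cong: tendsto_cong)
  then have "c = 0"
    by (simp add: tendsto_const_iff)
  with c assms(3) show ?thesis by simp
qed

text \<open>
  For \<open>d \<noteq> 0\<close> the function \<open>f s * exp (s / d)\<close> is constant. If \<open>d > 0\<close> its value at \<open>0\<close> is zero by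
  assumption; if \<open>d < 0\<close> it is a product of two functions that tend to zero. For \<open>d = 0\<close> the equation
  itself says \<open>f = 0\<close>.
\<close>

lemma decaying_scalar_ode:
  fixes f :: "real \<Rightarrow> real"
  assumes f': "\<And>s. 0 \<le> s \<Longrightarrow> (f has_real_derivative f' s) (at s within {0..})"
    and ode: "\<And>s. 0 \<le> s \<Longrightarrow> d * f' s = - f s"
    and lim: "(f \<longlongrightarrow> 0) at_top" and start: "0 < d \<Longrightarrow> f 0 = 0" and y: "0 \<le> y"
  shows "f y = 0"
proof (cases "d = 0")
  case True
  then show ?thesis using ode y by simp
next
  case False
  define h where "h s = f s * exp (s / d)" for s
  have "(h has_real_derivative 0) (at s within {0..})" if "0 \<le> s" for s
  proof -
    have "f' s * exp (s / d) + exp (s / d) * (1 / d) * f s = 0"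
    proof -
      have "f s = - (d * f' s)" using ode[OF that] by simp
      then show ?thesis using False by simp
    qed
    moreover have "((\<lambda>s. f s * exp (s / d)) has_real_derivative
        f' s * exp (s / d) + exp (s / d) * (1 / d) * f s) (at s within {0..})"
      by (rule DERIV_mult[OF f'[OF that]]) (auto intro!: derivative_eq_intros simp: False)
    ultimately show ?thesis
      by (simp add: h_def[abs_def])
  qed note h' = this
  have "h s = 0" if "0 \<le> s" for s
  proof (cases "0 < d")
    case True
    obtain c where "\<And>s. 0 \<le> s \<Longrightarrow> h s = c"
      using has_field_derivative_zero_constant[of "{0..}" h] h' by auto
    from this[of 0] this[of s] start[OF True] that show ?thesis
      by (simp add: h_def)
  next
    case neg: False
    have "((\<lambda>s. f s * exp (s / d)) \<longlongrightarrow> 0 * 0) at_top"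
    proof (intro tendsto_mult lim filterlim_compose[OF exp_at_bot])
      show "LIM s at_top. s / d :> at_bot"
        using filterlim_tendsto_neg_mult_at_bot[OF tendsto_const[of "1 / d"] _ filterlim_ident]
          False neg by simp
    qed
    then show ?thesis
      using decaying_constant_is_zero[OF h' _ that] by (simp add: h_def[abs_def])
  qed
  from this[OF y] show ?thesis by (simp add: h_def)
qed

text \<open>
  In the eigenbasis of \<open>S\<close> the system \<open>S c' = - c\<close> consists of independent scalar equations, to which
  \<open>decaying_scalar_ode\<close> applies. Nonpositive modes vanish identically, and positive modes do as soon as
  they vanish initially.
\<close>

lemma decaying_pencil_solution_mode:
  fixes S D P P' :: "real mat"
  assumes wit: "similar_mat_wit S D P P'" and D: "diagonal_mat D" and S: "S \<in> carrier_mat k k"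
    and c: "\<And>s. 0 \<le> s \<Longrightarrow> c s \<in> carrier_vec k"
    and c': "\<And>s. 0 \<le> s \<Longrightarrow> has_derivative_vec k c (c' s) (at s within {0..})"
    and ode: "\<And>s. 0 \<le> s \<Longrightarrow> S *\<^sub>v c' s = - c s"
    and lim: "tendsto_vec k c (0\<^sub>v k) at_top"
    and i: "i < k" and y: "0 \<le> y" and start: "0 < D $$ (i, i) \<Longrightarrow> (P' *\<^sub>v c 0) $ i = 0"
  shows "(P' *\<^sub>v c y) $ i = 0"
proof (rule decaying_scalar_ode[where f = "\<lambda>s. (P' *\<^sub>v c s) $ i" and f' = "\<lambda>s. (P' *\<^sub>v c' s) $ i" and d = "D $$ (i, i)"])
  note w = similar_mat_witD2[OF S wit]
  fix s :: real assume s: "0 \<le> s"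
  have c's: "c' s \<in> carrier_vec k" using c'[OF s] by (simp add: has_derivative_vec_def)
  show "((\<lambda>s. (P' *\<^sub>v c s) $ i) has_real_derivative (P' *\<^sub>v c' s) $ i) (at s within {0..})"
    using has_derivative_vec_mult_mat[OF w(7) c c'[OF s] s] i by (simp add: has_derivative_vec_def)
  have "P' *\<^sub>v (S *\<^sub>v c' s) = P' *\<^sub>v (P *\<^sub>v (D *\<^sub>v (P' *\<^sub>v c' s)))"
    using w(5-7) c's unfolding w(3) by (simp add: assoc_mult_mat_vec[of _ k k _ k])
  also have "\<dots> = (P' * P) *\<^sub>v (D *\<^sub>v (P' *\<^sub>v c' s))"
    using w(5-7) c's by (simp add: assoc_mult_mat_vec[of _ k k _ k])
  also have "\<dots> = D *\<^sub>v (P' *\<^sub>v c' s)"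
    unfolding w(2) using w(5-7) c's by simp
  finally have "(D *\<^sub>v (P' *\<^sub>v c' s)) $ i = (P' *\<^sub>v (- c s)) $ i"
    by (simp add: ode[OF s])
  then show "D $$ (i, i) * (P' *\<^sub>v c' s) $ i = - (P' *\<^sub>v c s) $ i"
    using diagonal_mult_vec_index[OF w(5) D _ i] w(7) c[OF s] c's i by simp
next
  show "((\<lambda>s. (P' *\<^sub>v c s) $ i) \<longlongrightarrow> 0) at_top"
    using tendsto_vec_mult_mat[OF similar_mat_witD2(7)[OF S wit] c lim] i by (simp add: tendsto_vec_def)
next
  show "0 < D $$ (i, i) \<Longrightarrow> (P' *\<^sub>v c 0) $ i = 0" by (rule start)
  show "0 \<le> y" by (rule y)
qed

section \<open>The decoupled system\<close>

text \<open>
  What the proof uses of the block structure: the products that vanish, the orthogonality relations,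
  that \<open>U = [G, U2, V3]\<close> and \<open>V = [V1, V2, V3]\<close> separate vectors, the inverses \<open>A21i\<close> and \<open>Q33i\<close> of the
  diagonal blocks, and a diagonalization \<open>S = P D P'\<close> of the reduced pencil. The equality of the
  column spaces of \<open>V2\<close> and \<open>A G\<close> enters through \<open>V2_zero\<close> and \<open>G_A_V3\<close>.
\<close>

locale decoupled_system =
  fixes N p r k q :: nat
    and A Q G V1 V2 V3 U2 A21i Q33i S T L D P P' :: "real mat"
  assumes A: "A \<in> carrier_mat N N" and Q: "Q \<in> carrier_mat N N" and G: "G \<in> carrier_mat N p"
    and V1: "V1 \<in> carrier_mat N r" and V2: "V2 \<in> carrier_mat N p" and V3: "V3 \<in> carrier_mat N k"
    and U2: "U2 \<in> carrier_mat N r"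
    and Q_V1: "Q * V1 = 0\<^sub>m N r" and G_Q: "G\<^sup>T * Q = 0\<^sub>m p N"
    and G_A_V1: "G\<^sup>T * A * V1 = 0\<^sub>m p r" and G_A_V3: "G\<^sup>T * A * V3 = 0\<^sub>m p k"
    and V3_A_V1: "V3\<^sup>T * A * V1 = 0\<^sub>m k r"
    and V2_zero: "\<And>x. x \<in> carrier_vec N \<Longrightarrow> G\<^sup>T *\<^sub>v (A *\<^sub>v x) = 0\<^sub>v p \<Longrightarrow> V2\<^sup>T *\<^sub>v x = 0\<^sub>v p"
    and U_separates: "\<And>x. x \<in> carrier_vec N \<Longrightarrow> G\<^sup>T *\<^sub>v x = 0\<^sub>v p \<Longrightarrow> U2\<^sup>T *\<^sub>v x = 0\<^sub>v r \<Longrightarrow>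
      V3\<^sup>T *\<^sub>v x = 0\<^sub>v k \<Longrightarrow> x = 0\<^sub>v N"
    and V_separates: "\<And>x. x \<in> carrier_vec N \<Longrightarrow> V1\<^sup>T *\<^sub>v x = 0\<^sub>v r \<Longrightarrow> V2\<^sup>T *\<^sub>v x = 0\<^sub>v p \<Longrightarrow>
      V3\<^sup>T *\<^sub>v x = 0\<^sub>v k \<Longrightarrow> x = 0\<^sub>v N"
    and V11: "V1\<^sup>T * V1 = 1\<^sub>m r" and V13: "V1\<^sup>T * V3 = 0\<^sub>m r k"
    and V21: "V2\<^sup>T * V1 = 0\<^sub>m p r" and V23: "V2\<^sup>T * V3 = 0\<^sub>m p k"
    and V31: "V3\<^sup>T * V1 = 0\<^sub>m k r" and V33: "V3\<^sup>T * V3 = 1\<^sub>m k"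
    and A21i: "A21i \<in> carrier_mat r r" "(U2\<^sup>T * A * V1) * A21i = 1\<^sub>m r" "A21i * (U2\<^sup>T * A * V1) = 1\<^sub>m r"
    and Q33i: "Q33i \<in> carrier_mat k k" "Q33i * (V3\<^sup>T * Q * V3) = 1\<^sub>m k" "(V3\<^sup>T * Q * V3) * Q33i = 1\<^sub>m k"
    and S_def: "S = Q33i * (V3\<^sup>T * A * V3)"
    and T: "T \<in> carrier_mat k q" and L: "L \<in> carrier_mat q q" "diagonal_mat L"
    and L_pos: "\<And>i. i < q \<Longrightarrow> 0 < L $$ (i, i)"
    and ST: "S * T = T * L" and T_indpt: "lin_indpt_cols T"
    and wit: "similar_mat_wit S D P P'" and D: "diagonal_mat D"
    and q: "q = card {i. i < k \<and> 0 < D $$ (i, i)}"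
begin

lemmas carr = A Q G V1 V2 V3 U2 T L(1) A21i(1) Q33i(1)

lemma S: "S \<in> carrier_mat k k"
  unfolding S_def using carr by simp

text \<open>
  The block relations, restated for iterated matrix-vector products in right-associated form, so that
  they serve as rewrite rules.
\<close>

lemma vec_rules:
  shows "x \<in> carrier_vec r \<Longrightarrow> Q *\<^sub>v (V1 *\<^sub>v x) = 0\<^sub>v N"
    and "y \<in> carrier_vec N \<Longrightarrow> G\<^sup>T *\<^sub>v (Q *\<^sub>v y) = 0\<^sub>v p"
    and "x \<in> carrier_vec r \<Longrightarrow> G\<^sup>T *\<^sub>v (A *\<^sub>v (V1 *\<^sub>v x)) = 0\<^sub>v p"
    and "z \<in> carrier_vec k \<Longrightarrow> G\<^sup>T *\<^sub>v (A *\<^sub>v (V3 *\<^sub>v z)) = 0\<^sub>v p"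
    and "x \<in> carrier_vec r \<Longrightarrow> V3\<^sup>T *\<^sub>v (A *\<^sub>v (V1 *\<^sub>v x)) = 0\<^sub>v k"
    and "x \<in> carrier_vec r \<Longrightarrow> V1\<^sup>T *\<^sub>v (V1 *\<^sub>v x) = x"
    and "z \<in> carrier_vec k \<Longrightarrow> V1\<^sup>T *\<^sub>v (V3 *\<^sub>v z) = 0\<^sub>v r"
    and "x \<in> carrier_vec r \<Longrightarrow> V2\<^sup>T *\<^sub>v (V1 *\<^sub>v x) = 0\<^sub>v p"
    and "z \<in> carrier_vec k \<Longrightarrow> V2\<^sup>T *\<^sub>v (V3 *\<^sub>v z) = 0\<^sub>v p"
    and "x \<in> carrier_vec r \<Longrightarrow> V3\<^sup>T *\<^sub>v (V1 *\<^sub>v x) = 0\<^sub>v k"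
    and "z \<in> carrier_vec k \<Longrightarrow> V3\<^sup>T *\<^sub>v (V3 *\<^sub>v z) = z"
    and "x \<in> carrier_vec r \<Longrightarrow> U2\<^sup>T *\<^sub>v (A *\<^sub>v (V1 *\<^sub>v (A21i *\<^sub>v x))) = x"
    and "x \<in> carrier_vec r \<Longrightarrow> A21i *\<^sub>v (U2\<^sup>T *\<^sub>v (A *\<^sub>v (V1 *\<^sub>v x))) = x"
    and "z \<in> carrier_vec k \<Longrightarrow> V3\<^sup>T *\<^sub>v (Q *\<^sub>v (V3 *\<^sub>v (S *\<^sub>v z))) = V3\<^sup>T *\<^sub>v (A *\<^sub>v (V3 *\<^sub>v z))"
    and "z \<in> carrier_vec k \<Longrightarrow> Q33i *\<^sub>v (V3\<^sup>T *\<^sub>v (Q *\<^sub>v (V3 *\<^sub>v z))) = z"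
    and "z \<in> carrier_vec k \<Longrightarrow> Q33i *\<^sub>v (V3\<^sup>T *\<^sub>v (A *\<^sub>v (V3 *\<^sub>v z))) = S *\<^sub>v z"
    and "t \<in> carrier_vec q \<Longrightarrow> S *\<^sub>v (T *\<^sub>v t) = T *\<^sub>v (L *\<^sub>v t)"
proof -
  have t: "G\<^sup>T \<in> carrier_mat p N" "V1\<^sup>T \<in> carrier_mat r N" "V2\<^sup>T \<in> carrier_mat p N"
    "V3\<^sup>T \<in> carrier_mat k N" "U2\<^sup>T \<in> carrier_mat r N" using carr by auto
  have two: "C *\<^sub>v (E *\<^sub>v v) = (C * E) *\<^sub>v v"
    if "C \<in> carrier_mat a b" "E \<in> carrier_mat b c" "v \<in> carrier_vec c" for C E :: "real mat" and v a b c
    using assoc_mult_mat_vec[OF that] by simp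
  show "x \<in> carrier_vec r \<Longrightarrow> Q *\<^sub>v (V1 *\<^sub>v x) = 0\<^sub>v N"
    by (simp only: two[OF Q V1] Q_V1 zero_mat_mult_vec)
  show "y \<in> carrier_vec N \<Longrightarrow> G\<^sup>T *\<^sub>v (Q *\<^sub>v y) = 0\<^sub>v p"
    by (simp only: two[OF t(1) Q] G_Q zero_mat_mult_vec)
  show "x \<in> carrier_vec r \<Longrightarrow> G\<^sup>T *\<^sub>v (A *\<^sub>v (V1 *\<^sub>v x)) = 0\<^sub>v p"
    by (simp only: mult_mat_vec_assoc3[OF t(1) A V1, symmetric] G_A_V1 zero_mat_mult_vec)
  show "z \<in> carrier_vec k \<Longrightarrow> G\<^sup>T *\<^sub>v (A *\<^sub>v (V3 *\<^sub>v z)) = 0\<^sub>v p"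
    by (simp only: mult_mat_vec_assoc3[OF t(1) A V3, symmetric] G_A_V3 zero_mat_mult_vec)
  show "x \<in> carrier_vec r \<Longrightarrow> V3\<^sup>T *\<^sub>v (A *\<^sub>v (V1 *\<^sub>v x)) = 0\<^sub>v k"
    by (simp only: mult_mat_vec_assoc3[OF t(4) A V1, symmetric] V3_A_V1 zero_mat_mult_vec)
  show "x \<in> carrier_vec r \<Longrightarrow> V1\<^sup>T *\<^sub>v (V1 *\<^sub>v x) = x"
    by (simp only: two[OF t(2) V1] V11 one_mult_mat_vec)
  show "z \<in> carrier_vec k \<Longrightarrow> V1\<^sup>T *\<^sub>v (V3 *\<^sub>v z) = 0\<^sub>v r"
    by (simp only: two[OF t(2) V3] V13 zero_mat_mult_vec)
  show "x \<in> carrier_vec r \<Longrightarrow> V2\<^sup>T *\<^sub>v (V1 *\<^sub>v x) = 0\<^sub>v p"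
    by (simp only: two[OF t(3) V1] V21 zero_mat_mult_vec)
  show "z \<in> carrier_vec k \<Longrightarrow> V2\<^sup>T *\<^sub>v (V3 *\<^sub>v z) = 0\<^sub>v p"
    by (simp only: two[OF t(3) V3] V23 zero_mat_mult_vec)
  show "x \<in> carrier_vec r \<Longrightarrow> V3\<^sup>T *\<^sub>v (V1 *\<^sub>v x) = 0\<^sub>v k"
    by (simp only: two[OF t(4) V1] V31 zero_mat_mult_vec)
  show "z \<in> carrier_vec k \<Longrightarrow> V3\<^sup>T *\<^sub>v (V3 *\<^sub>v z) = z"
    by (simp only: two[OF t(4) V3] V33 one_mult_mat_vec)
  have M: "U2\<^sup>T * A * V1 \<in> carrier_mat r r" "V3\<^sup>T * Q * V3 \<in> carrier_mat k k"
    "V3\<^sup>T * A * V3 \<in> carrier_mat k k" using carr t by auto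
  show "x \<in> carrier_vec r \<Longrightarrow> U2\<^sup>T *\<^sub>v (A *\<^sub>v (V1 *\<^sub>v (A21i *\<^sub>v x))) = x"
    using A21i(1)
    by (simp only: mult_mat_vec_assoc3[OF t(5) A V1, symmetric] two[OF M(1) A21i(1)] A21i(2)
        one_mult_mat_vec mult_mat_vec_carrier)
  show "x \<in> carrier_vec r \<Longrightarrow> A21i *\<^sub>v (U2\<^sup>T *\<^sub>v (A *\<^sub>v (V1 *\<^sub>v x))) = x"
    by (simp only: mult_mat_vec_assoc3[OF t(5) A V1, symmetric] two[OF A21i(1) M(1)] A21i(3)
        one_mult_mat_vec)
  have "V3\<^sup>T * Q * V3 * S = V3\<^sup>T * A * V3"
    unfolding S_def assoc_mult_mat[OF M(2) Q33i(1) M(3), symmetric] Q33i(3)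
    by (rule left_mult_one_mat[OF M(3)])
  then show "z \<in> carrier_vec k \<Longrightarrow> V3\<^sup>T *\<^sub>v (Q *\<^sub>v (V3 *\<^sub>v (S *\<^sub>v z))) = V3\<^sup>T *\<^sub>v (A *\<^sub>v (V3 *\<^sub>v z))"
    using S by (simp only: mult_mat_vec_assoc3[OF t(4) A V3, symmetric]
        mult_mat_vec_assoc3[OF t(4) Q V3, symmetric] two[OF M(2) S] mult_mat_vec_carrier)
  show "z \<in> carrier_vec k \<Longrightarrow> Q33i *\<^sub>v (V3\<^sup>T *\<^sub>v (Q *\<^sub>v (V3 *\<^sub>v z))) = z"
    by (simp only: mult_mat_vec_assoc3[OF t(4) Q V3, symmetric] two[OF Q33i(1) M(2)] Q33i(2)
        one_mult_mat_vec)
  show "z \<in> carrier_vec k \<Longrightarrow> Q33i *\<^sub>v (V3\<^sup>T *\<^sub>v (A *\<^sub>v (V3 *\<^sub>v z))) = S *\<^sub>v z"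
    by (simp only: mult_mat_vec_assoc3[OF t(4) A V3, symmetric] two[OF Q33i(1) M(3)] S_def)
  show "t \<in> carrier_vec q \<Longrightarrow> S *\<^sub>v (T *\<^sub>v t) = T *\<^sub>v (L *\<^sub>v t)"
    by (simp only: two[OF S T] two[OF T L(1)] ST)
qed

lemma transposed_carrier:
  "G\<^sup>T \<in> carrier_mat p N" "V1\<^sup>T \<in> carrier_mat r N" "V2\<^sup>T \<in> carrier_mat p N"
  "V3\<^sup>T \<in> carrier_mat k N" "U2\<^sup>T \<in> carrier_mat r N"
  by (simp_all only: transpose_carrier_mat carr)

lemmas carrier_rules = A[THEN mult_mat_vec_carrier] Q[THEN mult_mat_vec_carrier]
  transposed_carrier[THEN mult_mat_vec_carrier] V1[THEN mult_mat_vec_carrier]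
  V3[THEN mult_mat_vec_carrier] A21i(1)[THEN mult_mat_vec_carrier] S[THEN mult_mat_vec_carrier]
  T[THEN mult_mat_vec_carrier] L(1)[THEN mult_mat_vec_carrier]

lemmas distribs = mult_add_distrib_mat_vec[OF A] mult_add_distrib_mat_vec[OF Q]
  transposed_carrier[THEN mult_add_distrib_mat_vec]

lemma decomposition:
  assumes x: "x \<in> carrier_vec N" and x2: "V2\<^sup>T *\<^sub>v x = 0\<^sub>v p"
  shows "x = V1 *\<^sub>v (V1\<^sup>T *\<^sub>v x) + V3 *\<^sub>v (V3\<^sup>T *\<^sub>v x)"
proof -
  let ?y = "V1 *\<^sub>v (V1\<^sup>T *\<^sub>v x) + V3 *\<^sub>v (V3\<^sup>T *\<^sub>v x)"
  have y: "?y \<in> carrier_vec N" using x by (simp add: carrier_rules)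
  have "x - ?y = 0\<^sub>v N"
    by (rule V_separates)
      (use x y x2 in \<open>simp_all add: transposed_carrier[THEN mult_minus_distrib_mat_vec]
          distribs carrier_rules vec_rules\<close>)
  then show ?thesis using eq_vec_of_diff_zero[OF x y] by blast
qed

context
  fixes u
  assumes u: "decaying_solution A Q u"
begin

lemma u_carrier: "0 \<le> y \<Longrightarrow> u y \<in> carrier_vec N"
  using u A by (auto simp: decaying_solution_def)

lemma u_limit: "tendsto_vec N u (0\<^sub>v N) at_top"
  using u A by (auto simp: decaying_solution_def)

text \<open>
  A choice of derivative at every \<open>y \<ge> 0\<close>, as the definition of a solution only asserts existence
  pointwise.
\<close>

definition du where
  "du y = (SOME v. has_derivative_vec N u v (at y within {0..}) \<and> A *\<^sub>v v = - (Q *\<^sub>v u y))"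

lemma du:
  assumes "0 \<le> y"
  shows "has_derivative_vec N u (du y) (at y within {0..})" "A *\<^sub>v du y = - (Q *\<^sub>v u y)"
    "du y \<in> carrier_vec N"
proof -
  have "\<exists>v. has_derivative_vec N u v (at y within {0..}) \<and> A *\<^sub>v v = - (Q *\<^sub>v u y)"
    using u A assms by (auto simp: decaying_solution_def)
  from someI_ex[OF this]
  show "has_derivative_vec N u (du y) (at y within {0..})" "A *\<^sub>v du y = - (Q *\<^sub>v u y)"
    unfolding du_def by auto
  then show "du y \<in> carrier_vec N" by (simp add: has_derivative_vec_def)
qed

text \<open>
  \<open>G\<^sup>T A u\<close> has derivative \<open>- G\<^sup>T Q u = 0\<close> and tends to zero, hence vanishes.
\<close>

lemma solution_V2_zero:
  assumes y: "0 \<le> y"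
  shows "V2\<^sup>T *\<^sub>v u y = 0\<^sub>v p"
proof (rule V2_zero)
  have GA: "G\<^sup>T * A \<in> carrier_mat p N" using carr by simp
  have const: "(G\<^sup>T * A) *\<^sub>v du s = 0\<^sub>v p" if "0 \<le> s" for s
    using du[OF that] u_carrier[OF that]
    by (simp add: assoc_mult_mat_vec[OF transposed_carrier(1) A] vec_rules carrier_rules
        mult_mat_vec_uminus[OF transposed_carrier(1)])
  have "((G\<^sup>T * A) *\<^sub>v u y) $ i = 0" if i: "i < p" for i
  proof (rule decaying_constant_is_zero[where f = "\<lambda>s. ((G\<^sup>T * A) *\<^sub>v u s) $ i"])
    show "((\<lambda>s. ((G\<^sup>T * A) *\<^sub>v u s) $ i) has_real_derivative 0) (at s within {0..})"
      if "0 \<le> s" for s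
      using has_derivative_vec_mult_mat[OF GA u_carrier du(1)[OF that] that] const[OF that] i
      by (simp add: has_derivative_vec_def)
    show "((\<lambda>s. ((G\<^sup>T * A) *\<^sub>v u s) $ i) \<longlongrightarrow> 0) at_top"
      using tendsto_vec_mult_mat[OF GA u_carrier u_limit] i by (simp add: tendsto_vec_def)
  qed (rule y)
  then have "(G\<^sup>T * A) *\<^sub>v u y = 0\<^sub>v p"
    using GA by (intro eq_vecI) auto
  then show "G\<^sup>T *\<^sub>v (A *\<^sub>v u y) = 0\<^sub>v p"
    by (simp add: assoc_mult_mat_vec[OF transposed_carrier(1) A u_carrier[OF y]])
qed (rule u_carrier[OF y])

lemma derivative_zero_if_zero:
  assumes C: "C \<in> carrier_mat a N" and z: "\<And>s. 0 \<le> s \<Longrightarrow> C *\<^sub>v u s = 0\<^sub>v a" and y: "0 \<le> y"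
  shows "C *\<^sub>v du y = 0\<^sub>v a"
proof (rule eq_vecI)
  fix i assume "i < dim_vec (0\<^sub>v a :: real vec)"
  then have i: "i < a" by simp
  have "((\<lambda>s. (C *\<^sub>v u s) $ i) has_real_derivative (C *\<^sub>v du y) $ i) (at y within {0..})"
    using has_derivative_vec_mult_mat[OF C u_carrier du(1)[OF y] y] i
    by (simp add: has_derivative_vec_def)
  then have "(C *\<^sub>v du y) $ i = 0"
    by (rule has_real_derivative_zero_function) (use z i y in auto)
  then show "(C *\<^sub>v du y) $ i = 0\<^sub>v a $ i" using i by simp
qed (use C in auto)

lemma split_u: "0 \<le> y \<Longrightarrow> u y = V1 *\<^sub>v (V1\<^sup>T *\<^sub>v u y) + V3 *\<^sub>v (V3\<^sup>T *\<^sub>v u y)"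
  using decomposition solution_V2_zero u_carrier by blast

lemma split_du: "0 \<le> y \<Longrightarrow> du y = V1 *\<^sub>v (V1\<^sup>T *\<^sub>v du y) + V3 *\<^sub>v (V3\<^sup>T *\<^sub>v du y)"
  using decomposition derivative_zero_if_zero[OF transposed_carrier(3)] solution_V2_zero du(3)
  by blast

lemma split_Q:
  assumes y: "0 \<le> y"
  shows "Q *\<^sub>v u y = Q *\<^sub>v (V3 *\<^sub>v (V3\<^sup>T *\<^sub>v u y))"
proof -
  have "Q *\<^sub>v u y = Q *\<^sub>v (V1 *\<^sub>v (V1\<^sup>T *\<^sub>v u y) + V3 *\<^sub>v (V3\<^sup>T *\<^sub>v u y))"
    using split_u[OF y] by simp
  with u_carrier[OF y] show ?thesis
    by (simp add: distribs carrier_rules vec_rules)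
qed

lemma split_A:
  assumes y: "0 \<le> y"
  shows "A *\<^sub>v du y = A *\<^sub>v (V1 *\<^sub>v (V1\<^sup>T *\<^sub>v du y)) + A *\<^sub>v (V3 *\<^sub>v (V3\<^sup>T *\<^sub>v du y))"
proof -
  have "A *\<^sub>v du y = A *\<^sub>v (V1 *\<^sub>v (V1\<^sup>T *\<^sub>v du y) + V3 *\<^sub>v (V3\<^sup>T *\<^sub>v du y))"
    using split_du[OF y] by simp
  with du(3)[OF y] show ?thesis
    by (simp add: distribs carrier_rules)
qed

text \<open>
  Testing with \<open>V3\<close> eliminates the \<open>V1\<close> component on both sides.
\<close>

lemma reduced_equation:
  assumes y: "0 \<le> y"
  shows "S *\<^sub>v (V3\<^sup>T *\<^sub>v du y) = - (V3\<^sup>T *\<^sub>v u y)"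
proof -
  have c: "u y \<in> carrier_vec N" "du y \<in> carrier_vec N"
    using u_carrier du(3) y by auto
  have "V3\<^sup>T *\<^sub>v (A *\<^sub>v du y) = V3\<^sup>T *\<^sub>v (A *\<^sub>v (V3 *\<^sub>v (V3\<^sup>T *\<^sub>v du y)))"
    unfolding split_A[OF y] using c by (simp add: distribs carrier_rules vec_rules)
  then have "S *\<^sub>v (V3\<^sup>T *\<^sub>v du y) = Q33i *\<^sub>v (V3\<^sup>T *\<^sub>v (A *\<^sub>v du y))"
    using c by (simp add: carrier_rules vec_rules)
  also have "\<dots> = - (Q33i *\<^sub>v (V3\<^sup>T *\<^sub>v (Q *\<^sub>v (V3 *\<^sub>v (V3\<^sup>T *\<^sub>v u y)))))"
    unfolding du(2)[OF y] split_Q[OF y] using c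
    by (simp add: mult_mat_vec_uminus[OF transposed_carrier(4)] mult_mat_vec_uminus[OF Q33i(1)]
        carrier_rules)
  finally show ?thesis
    using c by (simp add: carrier_rules vec_rules)
qed

lemma reduced_mode_zero:
  assumes i: "i < k" and y: "0 \<le> y"
    and start: "0 < D $$ (i, i) \<Longrightarrow> (P' *\<^sub>v (V3\<^sup>T *\<^sub>v u 0)) $ i = 0"
  shows "(P' *\<^sub>v (V3\<^sup>T *\<^sub>v u y)) $ i = 0"
proof (rule decaying_pencil_solution_mode[OF wit D S, where c = "\<lambda>s. V3\<^sup>T *\<^sub>v u s" and c' = "\<lambda>s. V3\<^sup>T *\<^sub>v du s"])
  show "V3\<^sup>T *\<^sub>v u s \<in> carrier_vec k" if "0 \<le> s" for s
    using u_carrier[OF that] by (simp add: carrier_rules)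
  show "has_derivative_vec k (\<lambda>s. V3\<^sup>T *\<^sub>v u s) (V3\<^sup>T *\<^sub>v du s) (at s within {0..})" if "0 \<le> s" for s
    using has_derivative_vec_mult_mat[OF transposed_carrier(4) u_carrier du(1)[OF that] that] .
  show "tendsto_vec k (\<lambda>s. V3\<^sup>T *\<^sub>v u s) (0\<^sub>v k) at_top"
    using tendsto_vec_mult_mat[OF transposed_carrier(4) u_carrier u_limit] .
qed (use reduced_equation i y start in auto)

text \<open>
  The modes of the initial value with nonpositive eigenvalue vanish, and the others are spanned by \<open>T\<close>.
\<close>

lemma initial_value_in_range: "\<exists>z \<in> carrier_vec q. V3\<^sup>T *\<^sub>v u 0 = T *\<^sub>v z"
  using u_carrier[of 0] reduced_mode_zero[of _ 0]
  by (intro positive_eigenvectors_span[OF wit D S q T L L_pos ST T_indpt])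
    (auto simp: carrier_rules)

text \<open>
  The \<open>V3\<close> component vanishes mode by mode. Testing with \<open>U2\<close> then gives \<open>A21 (V1\<^sup>T u)' = 0\<close>, so the \<open>V1\<close>
  component is constant and, by decay, zero.
\<close>

lemma solution_zero:
  assumes start: "V3\<^sup>T *\<^sub>v u 0 = 0\<^sub>v k" and y: "0 \<le> y"
  shows "u y = 0\<^sub>v N"
proof -
  note w = similar_mat_witD2[OF S wit]
  have c: "u s \<in> carrier_vec N" "du s \<in> carrier_vec N" if "0 \<le> s" for s
    using u_carrier du(3) that by auto
  have V3u: "V3\<^sup>T *\<^sub>v u s = 0\<^sub>v k" if "0 \<le> s" for s
  proof -
    have "P' *\<^sub>v (V3\<^sup>T *\<^sub>v u s) = 0\<^sub>v k"
      using reduced_mode_zero[OF _ that] w(7)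
      by (intro eq_vecI) (auto simp: start mult_zero_vec[OF w(7)])
    then have "P *\<^sub>v (P' *\<^sub>v (V3\<^sup>T *\<^sub>v u s)) = 0\<^sub>v k"
      using w(6) by (simp add: mult_zero_vec)
    then show ?thesis
      using c[OF that] w(1) assoc_mult_mat_vec[OF w(6,7), of "V3\<^sup>T *\<^sub>v u s"] by (simp add: carrier_rules)
  qed
  have V3du: "V3\<^sup>T *\<^sub>v du s = 0\<^sub>v k" if "0 \<le> s" for s
    using derivative_zero_if_zero[OF transposed_carrier(4) V3u that] by simp
  have V1du: "V1\<^sup>T *\<^sub>v du s = 0\<^sub>v r" if "0 \<le> s" for s
  proof -
    have "Q *\<^sub>v u s = 0\<^sub>v N"
      unfolding split_Q[OF that] V3u[OF that] by (simp add: mult_zero_vec[OF V3] mult_zero_vec[OF Q])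
    then have "A *\<^sub>v (V1 *\<^sub>v (V1\<^sup>T *\<^sub>v du s)) = 0\<^sub>v N"
      using split_A[OF that] V3du[OF that] du(2)[OF that] c[OF that]
      by (simp add: mult_zero_vec[OF V3] mult_zero_vec[OF A] carrier_rules)
    moreover have "A21i *\<^sub>v (U2\<^sup>T *\<^sub>v 0\<^sub>v N) = 0\<^sub>v r"
      by (simp add: mult_zero_vec[OF transposed_carrier(5)] mult_zero_vec[OF A21i(1)])
    ultimately show ?thesis
      using vec_rules(13)[of "V1\<^sup>T *\<^sub>v du s"] c[OF that] by (simp add: carrier_rules)
  qed
  have "(V1\<^sup>T *\<^sub>v u y) $ i = 0" if i: "i < r" for i
  proof (rule decaying_constant_is_zero[where f = "\<lambda>s. (V1\<^sup>T *\<^sub>v u s) $ i"])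
    show "((\<lambda>s. (V1\<^sup>T *\<^sub>v u s) $ i) has_real_derivative 0) (at s within {0..})" if "0 \<le> s" for s
      using has_derivative_vec_mult_mat[OF transposed_carrier(2) u_carrier du(1)[OF that] that]
        V1du[OF that] i by (simp add: has_derivative_vec_def)
    show "((\<lambda>s. (V1\<^sup>T *\<^sub>v u s) $ i) \<longlongrightarrow> 0) at_top"
      using tendsto_vec_mult_mat[OF transposed_carrier(2) u_carrier u_limit] i
      by (simp add: tendsto_vec_def)
  qed (rule y)
  then have "V1\<^sup>T *\<^sub>v u y = 0\<^sub>v r"
    using V1 by (intro eq_vecI) auto
  with V3u[OF y] solution_V2_zero[OF y] c[OF y] show ?thesis
    using V_separates by blast
qed

end

text \<open>
  The vector \<open>exp (- \<Lambda>\<^sup>-\<^sup>1 y) z\<close>, written in coordinates.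
\<close>

definition decay_modes :: "real vec \<Rightarrow> real \<Rightarrow> real vec" where
  "decay_modes z y = vec q (\<lambda>i. exp (- (1 / L $$ (i, i)) * y) * z $ i)"

definition outer_coupling :: "real mat" where
  "outer_coupling = A21i * U2\<^sup>T * A * V3"

definition outer_forcing :: "real mat" where
  "outer_forcing = A21i * U2\<^sup>T * Q * V3"

text \<open>
  The constant matrix \<open>W\<close> of the explicit solution \<open>W exp (- \<Lambda>\<^sup>-\<^sup>1 y) z\<close>. The factor \<open>L\<close> in the \<open>V1\<close> part
  comes from \<open>\<integral>\<^sub>y\<^sup>\<infinity> exp (- \<Lambda>\<^sup>-\<^sup>1 s) ds = \<Lambda> exp (- \<Lambda>\<^sup>-\<^sup>1 y)\<close>.
\<close>

definition mode_profile :: "real mat" where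
  "mode_profile = V1 * (- (outer_coupling * T) + outer_forcing * T * L) + V3 * T"

lemma outer_carrier: "outer_coupling \<in> carrier_mat r k" "outer_forcing \<in> carrier_mat r k"
  unfolding outer_coupling_def outer_forcing_def using carr by auto

lemma outer_mult_vec:
  assumes "c \<in> carrier_vec k"
  shows "outer_coupling *\<^sub>v c = A21i *\<^sub>v (U2\<^sup>T *\<^sub>v (A *\<^sub>v (V3 *\<^sub>v c)))"
    and "outer_forcing *\<^sub>v c = A21i *\<^sub>v (U2\<^sup>T *\<^sub>v (Q *\<^sub>v (V3 *\<^sub>v c)))"
proof -
  have "A21i * U2\<^sup>T \<in> carrier_mat r N" using carr by simp
  from mult_mat_vec_assoc3[OF this _ V3 assms] A Q
  show "outer_coupling *\<^sub>v c = A21i *\<^sub>v (U2\<^sup>T *\<^sub>v (A *\<^sub>v (V3 *\<^sub>v c)))"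
    "outer_forcing *\<^sub>v c = A21i *\<^sub>v (U2\<^sup>T *\<^sub>v (Q *\<^sub>v (V3 *\<^sub>v c)))"
    unfolding outer_coupling_def outer_forcing_def
    using assms by (simp_all add: assoc_mult_mat_vec[OF A21i(1) transposed_carrier(5)] carrier_rules)
qed

lemma mode_profile_carrier: "mode_profile \<in> carrier_mat N q"
  unfolding mode_profile_def using V1 V3 T L(1) outer_carrier
  by (intro add_carrier_mat mult_carrier_mat[of _ N r] mult_carrier_mat[of _ N k])

lemma mode_profile_mult_vec:
  assumes x: "x \<in> carrier_vec q"
  shows "mode_profile *\<^sub>v x =
    V1 *\<^sub>v (- (outer_coupling *\<^sub>v (T *\<^sub>v x)) + outer_forcing *\<^sub>v (T *\<^sub>v (L *\<^sub>v x))) + V3 *\<^sub>v (T *\<^sub>v x)"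
proof -
  let ?F = "- (outer_coupling * T)" and ?H = "outer_forcing * T * L"
  have FH: "outer_coupling * T \<in> carrier_mat r q" "outer_forcing * T \<in> carrier_mat r q"
    using outer_carrier T by (blast intro: mult_carrier_mat)+
  then have F: "?F \<in> carrier_mat r q" and H: "?H \<in> carrier_mat r q"
    using mult_carrier_mat[OF FH(2) L(1)] by simp_all
  have "mode_profile *\<^sub>v x = V1 *\<^sub>v (?F *\<^sub>v x + ?H *\<^sub>v x) + V3 *\<^sub>v (T *\<^sub>v x)"
    unfolding mode_profile_def
    using add_mult_distrib_mat_vec[of "V1 * (?F + ?H)" N q "V3 * T" x]
      assoc_mult_mat_vec[of V1 N r "?F + ?H" q x] assoc_mult_mat_vec[OF V3 T x]
      add_mult_distrib_mat_vec[OF F H x] F H x V1 V3 T by simp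
  moreover have "?F *\<^sub>v x = - (outer_coupling *\<^sub>v (T *\<^sub>v x))"
    using outer_carrier T x by simp
  moreover have "?H *\<^sub>v x = outer_forcing *\<^sub>v (T *\<^sub>v (L *\<^sub>v x))"
    by (rule mult_mat_vec_assoc3[OF outer_carrier(2) T L(1) x])
  ultimately show ?thesis by simp
qed

lemma mode_profile_blocks:
  assumes x: "x \<in> carrier_vec q"
  shows "V1\<^sup>T *\<^sub>v (mode_profile *\<^sub>v x) =
      - (outer_coupling *\<^sub>v (T *\<^sub>v x)) + outer_forcing *\<^sub>v (T *\<^sub>v (L *\<^sub>v x))"
    and "V2\<^sup>T *\<^sub>v (mode_profile *\<^sub>v x) = 0\<^sub>v p"
    and "V3\<^sup>T *\<^sub>v (mode_profile *\<^sub>v x) = T *\<^sub>v x"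
proof -
  let ?h = "- (outer_coupling *\<^sub>v (T *\<^sub>v x)) + outer_forcing *\<^sub>v (T *\<^sub>v (L *\<^sub>v x))"
  have h: "?h \<in> carrier_vec r" and t: "T *\<^sub>v x \<in> carrier_vec k"
    using outer_carrier x by (auto simp: carrier_rules)
  show "V1\<^sup>T *\<^sub>v (mode_profile *\<^sub>v x) = ?h" "V2\<^sup>T *\<^sub>v (mode_profile *\<^sub>v x) = 0\<^sub>v p"
    "V3\<^sup>T *\<^sub>v (mode_profile *\<^sub>v x) = T *\<^sub>v x"
    unfolding mode_profile_mult_vec[OF x] using h t
    by (simp_all add: distribs carrier_rules vec_rules)
qed

text \<open>
  This is \<open>A W = Q W \<Lambda>\<close>, tested with the three blocks of \<open>U\<close>. Both sides vanish against \<open>G\<close>; against \<open>V3\<close>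
  the identity is the eigenvector equation \<open>A33 T = Q33 T \<Lambda>\<close>; against \<open>U2\<close> the \<open>V1\<close> part of \<open>W\<close> was chosen
  so that it holds.
\<close>

lemma mode_profile_equation:
  assumes x: "x \<in> carrier_vec q"
  shows "A *\<^sub>v (mode_profile *\<^sub>v x) = Q *\<^sub>v (mode_profile *\<^sub>v (L *\<^sub>v x))"
proof -
  let ?Fx = "outer_coupling *\<^sub>v (T *\<^sub>v x)" and ?Hx = "outer_forcing *\<^sub>v (T *\<^sub>v (L *\<^sub>v x))"
  let ?h = "- ?Fx + ?Hx"
  let ?h' = "- (outer_coupling *\<^sub>v (T *\<^sub>v (L *\<^sub>v x))) + outer_forcing *\<^sub>v (T *\<^sub>v (L *\<^sub>v (L *\<^sub>v x)))"
  let ?l = "A *\<^sub>v (mode_profile *\<^sub>v x)" and ?r = "Q *\<^sub>v (mode_profile *\<^sub>v (L *\<^sub>v x))"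
  have Lx: "L *\<^sub>v x \<in> carrier_vec q" and c: "T *\<^sub>v x \<in> carrier_vec k" "T *\<^sub>v (L *\<^sub>v x) \<in> carrier_vec k"
    using x by (auto simp: carrier_rules)
  have F: "?Fx \<in> carrier_vec r" and H: "?Hx \<in> carrier_vec r" and h: "?h \<in> carrier_vec r"
    and h': "?h' \<in> carrier_vec r"
    using outer_carrier x by (auto simp: carrier_rules)
  have lr: "?l \<in> carrier_vec N" "?r \<in> carrier_vec N"
    using mode_profile_carrier x by (auto simp: carrier_rules)
  have l: "?l = A *\<^sub>v (V1 *\<^sub>v ?h) + A *\<^sub>v (V3 *\<^sub>v (T *\<^sub>v x))"
    unfolding mode_profile_mult_vec[OF x] using h c by (simp add: distribs carrier_rules)
  have r: "?r = Q *\<^sub>v (V3 *\<^sub>v (T *\<^sub>v (L *\<^sub>v x)))"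
    unfolding mode_profile_mult_vec[OF Lx] using h' c by (simp add: distribs carrier_rules vec_rules)
  have U2l: "U2\<^sup>T *\<^sub>v ?l = U2\<^sup>T *\<^sub>v ?r"
  proof -
    have "U2\<^sup>T *\<^sub>v (A *\<^sub>v (V1 *\<^sub>v ?h)) =
        - (U2\<^sup>T *\<^sub>v (A *\<^sub>v (V1 *\<^sub>v ?Fx))) + U2\<^sup>T *\<^sub>v (A *\<^sub>v (V1 *\<^sub>v ?Hx))"
      using F H by (simp add: distribs carrier_rules mult_add_distrib_mat_vec[OF V1]
          mult_mat_vec_uminus[OF V1] mult_mat_vec_uminus[OF A] mult_mat_vec_uminus[OF transposed_carrier(5)])
    also have "\<dots> = - (U2\<^sup>T *\<^sub>v (A *\<^sub>v (V3 *\<^sub>v (T *\<^sub>v x)))) + U2\<^sup>T *\<^sub>v ?r"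
      unfolding r outer_mult_vec[OF c(1)] outer_mult_vec[OF c(2)]
      using c by (simp add: vec_rules carrier_rules)
    finally have "U2\<^sup>T *\<^sub>v ?l = - (U2\<^sup>T *\<^sub>v (A *\<^sub>v (V3 *\<^sub>v (T *\<^sub>v x)))) + U2\<^sup>T *\<^sub>v ?r
        + U2\<^sup>T *\<^sub>v (A *\<^sub>v (V3 *\<^sub>v (T *\<^sub>v x)))"
      unfolding l using h c by (simp add: distribs carrier_rules)
    also have "\<dots> = U2\<^sup>T *\<^sub>v ?r"
      using carrier_rules(7)[OF lr(2)] carrier_rules(7)[OF carrier_rules(1)[OF carrier_rules(9)[OF c(1)]]]
      by (intro eq_vecI) auto
    finally show ?thesis .
  qed
  have V3l: "V3\<^sup>T *\<^sub>v ?l = V3\<^sup>T *\<^sub>v ?r"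
    unfolding l r using h c vec_rules(14)[OF c(1)] vec_rules(17)[OF x]
    by (simp add: distribs carrier_rules vec_rules(5))
  have Gl: "G\<^sup>T *\<^sub>v ?l = G\<^sup>T *\<^sub>v ?r"
    unfolding l r using h c by (simp add: distribs carrier_rules vec_rules)
  have "?l - ?r = 0\<^sub>v N"
    by (rule U_separates)
      (use lr in \<open>simp_all add: transposed_carrier[THEN mult_minus_distrib_mat_vec] U2l V3l Gl carrier_rules\<close>)
  then show ?thesis using eq_vec_of_diff_zero[OF lr] by blast
qed

lemma decay_modes_carrier: "decay_modes z y \<in> carrier_vec q"
  by (simp add: decay_modes_def)

lemma decay_modes_tendsto: "tendsto_vec q (decay_modes z) (0\<^sub>v q) at_top"
  unfolding tendsto_vec_def
proof (intro conjI allI impI)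
  fix i assume i: "i < q"
  have "LIM y at_top. - (1 / L $$ (i, i)) * y :> at_bot"
    using L_pos[OF i]
    by (intro filterlim_tendsto_neg_mult_at_bot[OF tendsto_const _ filterlim_ident]) auto
  then have "((\<lambda>y. exp (- (1 / L $$ (i, i)) * y) * z $ i) \<longlongrightarrow> 0 * z $ i) at_top"
    by (intro tendsto_mult tendsto_const filterlim_compose[OF exp_at_bot])
  then show "((\<lambda>y. decay_modes z y $ i) \<longlongrightarrow> 0\<^sub>v q $ i) at_top"
    using i by (simp add: decay_modes_def)
qed simp

lemma decay_modes_derivative:
  obtains e' where "has_derivative_vec q (decay_modes z) e' (at y within {0..})"
    and "L *\<^sub>v e' = - decay_modes z y"
proof
  let ?e' = "vec q (\<lambda>i. - (1 / L $$ (i, i)) * exp (- (1 / L $$ (i, i)) * y) * z $ i)"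
  show "has_derivative_vec q (decay_modes z) ?e' (at y within {0..})"
    unfolding has_derivative_vec_def decay_modes_def
    by (auto intro!: derivative_eq_intros simp: L_pos[THEN less_imp_neq, THEN not_sym])
  show "L *\<^sub>v ?e' = - decay_modes z y"
  proof (rule eq_vecI)
    fix i assume "i < dim_vec (- decay_modes z y)"
    then have i: "i < q" by (simp add: decay_modes_def)
    show "(L *\<^sub>v ?e') $ i = (- decay_modes z y) $ i"
      using diagonal_mult_vec_index[OF L, of ?e' i] i L_pos[OF i] by (simp add: decay_modes_def)
  qed (use L in \<open>auto simp: decay_modes_def\<close>)
qed

lemma decay_modes_integral: "has_integral_vec q (decay_modes z) (L *\<^sub>v decay_modes z y) {y..}"
  unfolding has_integral_vec_def
proof (intro conjI allI impI)
  show "L *\<^sub>v decay_modes z y \<in> carrier_vec q"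
    by (simp add: carrier_rules decay_modes_carrier)
  fix i assume i: "i < q"
  have "((\<lambda>s. exp (- (1 / L $$ (i, i)) * s) * z $ i) has_integral
      exp (- (1 / L $$ (i, i)) * y) / (1 / L $$ (i, i)) * z $ i) {y..}"
    using L_pos[OF i] by (intro has_integral_mult_left has_integral_exp_minus_to_infinity) simp
  then show "((\<lambda>s. decay_modes z s $ i) has_integral (L *\<^sub>v decay_modes z y) $ i) {y..}"
    using diagonal_mult_vec_index[OF L decay_modes_carrier i] i
    by (simp add: decay_modes_def mult_ac)
qed

lemma mode_solution_decays: "decaying_solution A Q (\<lambda>y. mode_profile *\<^sub>v decay_modes z y)"
  unfolding decaying_solution_def carrier_matD[OF A]
proof (intro conjI allI impI)
  fix y :: real assume y: "0 \<le> y"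
  show "mode_profile *\<^sub>v decay_modes z y \<in> carrier_vec N"
    using mode_profile_carrier decay_modes_carrier by simp
  obtain e' where e': "has_derivative_vec q (decay_modes z) e' (at y within {0..})"
    "L *\<^sub>v e' = - decay_modes z y"
    by (rule decay_modes_derivative)
  have c: "e' \<in> carrier_vec q" using e'(1) by (simp add: has_derivative_vec_def)
  have "A *\<^sub>v (mode_profile *\<^sub>v e') = - (Q *\<^sub>v (mode_profile *\<^sub>v decay_modes z y))"
    unfolding mode_profile_equation[OF c] e'(2)
    using mode_profile_carrier decay_modes_carrier
    by (simp add: mult_mat_vec_uminus[OF mode_profile_carrier] mult_mat_vec_uminus[OF Q])
  with has_derivative_vec_mult_mat[OF mode_profile_carrier decay_modes_carrier e'(1) y]
  show "\<exists>w'. has_derivative_vec N (\<lambda>y. mode_profile *\<^sub>v decay_modes z y) w' (at y within {0..}) \<and>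
      A *\<^sub>v w' = - (Q *\<^sub>v (mode_profile *\<^sub>v decay_modes z y))"
    by blast
qed (rule tendsto_vec_mult_mat[OF mode_profile_carrier decay_modes_carrier decay_modes_tendsto])

lemma mode_solution_integral:
  "has_integral_vec r (\<lambda>s. outer_forcing *\<^sub>v (V3\<^sup>T *\<^sub>v (mode_profile *\<^sub>v decay_modes z s)))
    (outer_forcing *\<^sub>v (T *\<^sub>v (L *\<^sub>v decay_modes z y))) {y..}"
proof -
  have C: "outer_forcing * T \<in> carrier_mat r q" using outer_carrier T by simp
  have L': "L *\<^sub>v decay_modes z y \<in> carrier_vec q" by (simp add: carrier_rules decay_modes_carrier)
  show ?thesis
    using has_integral_vec_mult_mat[OF C decay_modes_carrier decay_modes_integral[of z y]]
    by (simp add: mode_profile_blocks decay_modes_carrier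
        assoc_mult_mat_vec[OF outer_carrier(2) T decay_modes_carrier]
        assoc_mult_mat_vec[OF outer_carrier(2) T L'])
qed

end

section \<open>Existence and uniqueness for the boundary value problem\<close>

theorem theorem2p1:
  fixes m n p r n_plus :: nat
    and M A Q Qe Qo G X V1 V2 V3 U1 U2 Q33 A33 T_plus L_plus B A21 :: "real mat"
    and g :: "real vec"
  assumes "n \<le> m"
    and "M \<in> carrier_mat m n" and "vec_space.rank m M = n"
    and "Qe \<in> carrier_mat m m" and "symmetric_psd Qe"
    and "Qo \<in> carrier_mat n n" and "symmetric_psd Qo"
    and "A = four_block_mat (0\<^sub>m m m) M (M\<^sup>T) (0\<^sub>m n n)"
    and "Q = four_block_mat Qe (0\<^sub>m m n) (0\<^sub>m n m) Qo"
    and "mat_kernel A \<inter> mat_kernel Q = {0\<^sub>v (m + n)}"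
    and "G \<in> carrier_mat (m + n) p" and "orthonormal_basis_mat G (mat_kernel Q)"
    and "X \<in> carrier_mat p r" and "orthonormal_basis_mat X (mat_kernel (G\<^sup>T * A * G))"
    and "V1 = G * X" and "U1 = G" and "U2 = A * G * X"
    and "V2 \<in> carrier_mat (m + n) p" and "V3 \<in> carrier_mat (m + n) (m + n - p - r)"
    and "vec_space.col_space (m + n) V2 = vec_space.col_space (m + n) (A * G)"
    and "square_orthogonal (append_three V1 V2 V3)"
    and "invertible_mat (append_three U1 U2 V3)"
    and "vec_space.rank r (U2\<^sup>T * A * V1) = r"
    and "V3\<^sup>T * A * V1 = 0\<^sub>m (m + n - p - r) r"
    and "symmetric_pd (V3\<^sup>T * Q * V3)"
    and "Q33 = V3\<^sup>T * Q * V3" and "A33 = V3\<^sup>T * A * V3"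
    and "n_plus = num_pos_eigenvalues (inv_mat Q33 * A33)"
    and "T_plus \<in> carrier_mat (m + n - p - r) n_plus"
    and "L_plus \<in> carrier_mat n_plus n_plus" and "diagonal_mat L_plus"
    and "\<forall>i<n_plus. 0 < L_plus $$ (i, i)"
    and "inv_mat Q33 * A33 * T_plus = T_plus * L_plus"
    and "lin_indpt_cols T_plus"
    and "B \<in> carrier_mat n (m + n)" and "g \<in> carrier_vec n"
    and "vec_space.rank n (B * V3 * T_plus) = n_plus"
    and "g \<in> vec_space.col_space n (B * V3 * T_plus)"
    and "A21 = U2\<^sup>T * A * V1"
  shows "\<exists>w z0.
      (decaying_solution A Q w \<and> B * V3 *\<^sub>v (V3\<^sup>T *\<^sub>v w 0) = g) \<and>
      (\<forall>w'. decaying_solution A Q w' \<and> B * V3 *\<^sub>v (V3\<^sup>T *\<^sub>v w' 0) = g \<longrightarrow>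
         (\<forall>y\<ge>0. w' y = w y)) \<and>
      (z0 \<in> carrier_vec n_plus \<and> B * V3 *\<^sub>v (T_plus *\<^sub>v z0) = g) \<and>
      (\<forall>z'. z' \<in> carrier_vec n_plus \<and> B * V3 *\<^sub>v (T_plus *\<^sub>v z') = g \<longrightarrow> z' = z0) \<and>
      (\<forall>y\<ge>0.
         V2\<^sup>T *\<^sub>v w y = 0\<^sub>v p \<and>
         V3\<^sup>T *\<^sub>v w y = T_plus *\<^sub>v (mat_exp (- (y \<cdot>\<^sub>m inv_mat L_plus)) *\<^sub>v z0) \<and>
         (\<exists>I. has_integral_vec r
                (\<lambda>s. inv_mat A21 * U2\<^sup>T * Q * V3 *\<^sub>v (V3\<^sup>T *\<^sub>v w s)) I {y..} \<and>
              V1\<^sup>T *\<^sub>v w y = - (inv_mat A21 * U2\<^sup>T * A * V3 *\<^sub>v (V3\<^sup>T *\<^sub>v w y)) + I))"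
proof -
  define N k where "N = m + n" and "k = m + n - p - r"
  have A: "A \<in> carrier_mat N N" and Q: "Q \<in> carrier_mat N N"
    unfolding assms(8,9) N_def using assms(2,4,6) by auto
  have Asym: "A\<^sup>T = A"
    unfolding assms(8) using assms(2) by (subst transpose_four_block_mat[of _ m m _ n _ n]) auto
  have "Qe\<^sup>T = Qe" "Qo\<^sup>T = Qo"
    using assms(5,7) by (auto simp: symmetric_psd_def)
  then have Qsym: "Q\<^sup>T = Q"
    unfolding assms(9) using assms(4,6) by (subst transpose_four_block_mat[of _ m m _ n _ n]) auto
  have G: "G \<in> carrier_mat N p" and X: "X \<in> carrier_mat p r" and V2: "V2 \<in> carrier_mat N p"
    and V3: "V3 \<in> carrier_mat N k" and T: "T_plus \<in> carrier_mat k n_plus"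
    and L: "L_plus \<in> carrier_mat n_plus n_plus" and B: "B \<in> carrier_mat n N"
    using assms(11,13,18,19,29,30,35) unfolding N_def k_def by auto
  have V1: "V1 \<in> carrier_mat N r" and AG: "A * G \<in> carrier_mat N p" and U2: "U2 \<in> carrier_mat N r"
    unfolding assms(15,17) using A G X by (auto intro: mult_carrier_mat)
  have Gt: "G\<^sup>T \<in> carrier_mat p N" and V1t: "V1\<^sup>T \<in> carrier_mat r N" and V2t: "V2\<^sup>T \<in> carrier_mat p N"
    and V3t: "V3\<^sup>T \<in> carrier_mat k N" and U2t: "U2\<^sup>T \<in> carrier_mat r N"
    by (simp_all only: transpose_carrier_mat G V1 V2 V3 U2)

  note Vcols = col_append_three(1)[OF V1 V2 V3]
  \<comment> \<open>Squareness of \<open>V\<close> excludes truncation of \<open>m + n - p - r\<close>.\<close>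
  have sum: "r + p + k = N"
    using assms(21) Vcols unfolding square_orthogonal_def by auto
  have Vorth: "column_orthogonal (append_three V1 V2 V3)"
    using assms(21) unfolding square_orthogonal_def by simp
  note orth = column_orthogonal_append_three[OF V1 V2 V3 Vorth]
  have detV: "det (append_three V1 V2 V3) \<noteq> 0"
  proof -
    let ?V = "append_three V1 V2 V3"
    have "?V \<in> carrier_mat N N" using Vcols sum by simp
    moreover from this have "?V\<^sup>T * ?V = 1\<^sub>m N"
      using Vorth unfolding column_orthogonal_def by simp
    ultimately show ?thesis
      using det_mult[of "?V\<^sup>T" N ?V] by auto
  qed
  have detU: "det (append_three G U2 V3) \<noteq> 0"
    using invertible_mat_det[of "append_three G U2 V3" N] col_append_three(1)[OF G U2 V3] sum
      assms(22) unfolding assms(16) by (simp add: add.commute)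

  have QG: "Q *\<^sub>v (G *\<^sub>v x) = 0\<^sub>v N" if "x \<in> carrier_vec p" for x
  proof -
    have "G *\<^sub>v x \<in> mat_kernel Q"
      using col_space_memI[OF G that] assms(12) G unfolding orthonormal_basis_mat_def by auto
    then show ?thesis using mat_kernelD(2)[OF Q] by blast
  qed
  have Q_G: "Q * G = 0\<^sub>m N p"
    using QG Q G by (intro zero_mat_if_annihilates)
      (auto simp: assoc_mult_mat_vec[OF Q G] intro: mult_carrier_mat)
  have Q_V1: "Q * V1 = 0\<^sub>m N r"
    unfolding assms(15) assoc_mult_mat[OF Q G X, symmetric] Q_G using X by simp
  have G_Q: "G\<^sup>T * Q = 0\<^sub>m p N"
    using arg_cong[OF Q_G, of transpose_mat] by (simp add: transpose_mult[OF Q G] Qsym)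
  have GtA: "G\<^sup>T * A \<in> carrier_mat p N"
    by (rule mult_carrier_mat[OF Gt A])
  have GAG: "G\<^sup>T * A * G \<in> carrier_mat p p"
    by (rule mult_carrier_mat[OF GtA G])
  have "(G\<^sup>T * A * G) * X = 0\<^sub>m p r"
  proof (rule zero_mat_if_annihilates)
    fix x :: "real vec" assume x: "x \<in> carrier_vec r"
    have "X *\<^sub>v x \<in> mat_kernel (G\<^sup>T * A * G)"
      using col_space_memI[OF X x] assms(14) X unfolding orthonormal_basis_mat_def by auto
    then show "(G\<^sup>T * A * G * X) *\<^sub>v x = 0\<^sub>v p"
      unfolding assoc_mult_mat_vec[OF GAG X x] by (rule mat_kernelD(2)[OF GAG])
  qed (rule mult_carrier_mat[OF GAG X])
  then have G_A_V1: "G\<^sup>T * A * V1 = 0\<^sub>m p r"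
    unfolding assms(15) assoc_mult_mat[OF GtA G X, symmetric] .
  have V3A: "V3\<^sup>T * A \<in> carrier_mat k N"
    by (rule mult_carrier_mat[OF V3t A])
  have V3AG: "V3\<^sup>T * A * G = 0\<^sub>m k p"
  proof (rule zero_mat_if_annihilates)
    fix x :: "real vec" assume x: "x \<in> carrier_vec p"
    have "(A * G) *\<^sub>v x \<in> vec_space.col_space N V2"
      using col_space_memI[OF AG x] assms(20) unfolding N_def by simp
    then obtain y where y: "y \<in> carrier_vec p" "(A * G) *\<^sub>v x = V2 *\<^sub>v y"
      by (rule col_space_memD[OF V2])
    have "(V3\<^sup>T * A * G) *\<^sub>v x = V3\<^sup>T *\<^sub>v (V2 *\<^sub>v y)"
      unfolding assoc_mult_mat[OF V3t A G] assoc_mult_mat_vec[OF V3t AG x] y(2) ..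
    also have "\<dots> = 0\<^sub>v k"
      unfolding assoc_mult_mat_vec[OF V3t V2 y(1), symmetric] orth(9) by (rule zero_mat_mult_vec[OF y(1)])
    finally show "(V3\<^sup>T * A * G) *\<^sub>v x = 0\<^sub>v k" .
  qed (rule mult_carrier_mat[OF V3A G])
  have G_A_V3: "G\<^sup>T * A * V3 = 0\<^sub>m p k"
  proof -
    have "(V3\<^sup>T * A * G)\<^sup>T = G\<^sup>T * (A * V3)"
      unfolding transpose_mult[OF V3A G] transpose_mult[OF V3t A] Asym by simp
    then show ?thesis
      unfolding V3AG assoc_mult_mat[OF Gt A V3] by simp
  qed
  have V2_zero: "V2\<^sup>T *\<^sub>v x = 0\<^sub>v p"
    if x: "x \<in> carrier_vec N" and GAx: "G\<^sup>T *\<^sub>v (A *\<^sub>v x) = 0\<^sub>v p" for x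
  proof (rule eq_vecI)
    fix i assume "i < dim_vec (0\<^sub>v p :: real vec)"
    then have i: "i < p" by simp
    have e: "unit_vec p i \<in> carrier_vec p" by simp
    \<comment> \<open>The component is \<open>x \<bullet> V2 e\<^sub>i\<close>, and \<open>V2 e\<^sub>i = A G y\<close> moves \<open>A\<close> and \<open>G\<close> over to \<open>x\<close>.\<close>
    have "V2 *\<^sub>v unit_vec p i \<in> vec_space.col_space N (A * G)"
      using col_space_memI[OF V2 e] assms(20) unfolding N_def by simp
    then obtain y where y: "y \<in> carrier_vec p" "V2 *\<^sub>v unit_vec p i = (A * G) *\<^sub>v y"
      by (rule col_space_memD[OF AG])
    have Gy: "G *\<^sub>v y \<in> carrier_vec N" and Ax: "A *\<^sub>v x \<in> carrier_vec N"
      using y(1) x A G by auto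
    have "(V2\<^sup>T *\<^sub>v x) $ i = (V2\<^sup>T *\<^sub>v x) \<bullet> unit_vec p i"
      using i V2t x by (simp add: scalar_prod_right_unit[of _ p])
    also have "\<dots> = x \<bullet> (A *\<^sub>v (G *\<^sub>v y))"
      unfolding transpose_vec_mult_scalar[OF V2 e x] y(2) assoc_mult_mat_vec[OF A G y(1)] ..
    also have "\<dots> = (G\<^sup>T *\<^sub>v (A *\<^sub>v x)) \<bullet> y"
      unfolding transpose_vec_mult_scalar[OF G y(1) Ax] symmetric_form_swap[OF A Asym x Gy]
      by (rule comm_scalar_prod[OF Gy Ax])
    also have "\<dots> = 0"
      unfolding GAx using y(1) by simp
    finally show "(V2\<^sup>T *\<^sub>v x) $ i = 0\<^sub>v p $ i" using i by simp
  qed (use V2 in simp)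

  have A21: "A21 \<in> carrier_mat r r"
    unfolding assms(39) by (rule mult_carrier_mat[OF mult_carrier_mat[OF U2t A] V1])
  have "det A21 \<noteq> 0"
    using vec_space.det_rank_iff[OF A21] assms(23) unfolding assms(39) by simp
  note A21i = det_nonzero_inv_mat[OF A21 this]
  have Q33: "Q33 \<in> carrier_mat k k" and A33: "A33 \<in> carrier_mat k k"
    unfolding assms(26,27) using mult_carrier_mat[OF mult_carrier_mat[OF V3t Q] V3]
      mult_carrier_mat[OF V3A V3] by auto
  have Q33pd: "symmetric_pd Q33"
    using assms(25,26) by simp
  note Q33i = det_nonzero_inv_mat[OF Q33 symmetric_pd_det[OF Q33 Q33pd]]
  have A33sym: "A33\<^sup>T = A33"
    unfolding assms(27) transpose_mult[OF V3A V3] transpose_mult[OF V3t A] Asym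
    using assoc_mult_mat[OF V3t A V3] by simp
  define S where "S = inv_mat Q33 * A33"
  have S: "S \<in> carrier_mat k k"
    unfolding S_def by (rule mult_carrier_mat[OF Q33i(1) A33])
  have QS: "Q33 * S = A33"
    unfolding S_def assoc_mult_mat[OF Q33 Q33i(1) A33, symmetric] Q33i(2)
    by (rule left_mult_one_mat[OF A33])
  obtain D P P' where wit: "similar_mat_wit S D P P'" and D: "diagonal_mat D"
    by (rule symmetric_pencil_diagonalizable[OF A33 A33sym Q33 Q33pd S QS])
  interpret decoupled_system N p r k n_plus A Q G V1 V2 V3 U2 "inv_mat A21" "inv_mat Q33" S
    T_plus L_plus D P P'
  proof
    show "x = 0\<^sub>v N" if "x \<in> carrier_vec N" "G\<^sup>T *\<^sub>v x = 0\<^sub>v p" "U2\<^sup>T *\<^sub>v x = 0\<^sub>v r" "V3\<^sup>T *\<^sub>v x = 0\<^sub>v k" for x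
      using append_three_separates[OF G U2 V3 detU _ that] sum by simp
    show "x = 0\<^sub>v N" if "x \<in> carrier_vec N" "V1\<^sup>T *\<^sub>v x = 0\<^sub>v r" "V2\<^sup>T *\<^sub>v x = 0\<^sub>v p" "V3\<^sup>T *\<^sub>v x = 0\<^sub>v k" for x
      by (rule append_three_separates[OF V1 V2 V3 detV sum that])
    show "V3\<^sup>T * A * V1 = 0\<^sub>m k r"
      using assms(24) unfolding k_def .
    show "n_plus = card {i. i < k \<and> 0 < D $$ (i, i)}"
      using assms(28) num_pos_eigenvalues_similar_diagonal[OF wit D S] unfolding S_def by simp
    show "0 < L_plus $$ (i, i)" if "i < n_plus" for i
      using assms(32) that by simp
    show "S * T_plus = T_plus * L_plus"
      using assms(33) unfolding S_def .
    show "S = inv_mat Q33 * (V3\<^sup>T * A * V3)"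
      using assms(27) unfolding S_def by simp
    show "U2\<^sup>T * A * V1 * inv_mat A21 = 1\<^sub>m r" "inv_mat A21 * (U2\<^sup>T * A * V1) = 1\<^sub>m r"
      using A21i(2,3) by (simp_all only: assms(39)[symmetric])
    show "inv_mat Q33 * (V3\<^sup>T * Q * V3) = 1\<^sub>m k" "V3\<^sup>T * Q * V3 * inv_mat Q33 = 1\<^sub>m k"
      using Q33i(2,3) by (simp_all only: assms(26)[symmetric])
  qed (fact A Q G V1 V2 V3 U2 Q_V1 G_Q G_A_V1 G_A_V3 V2_zero orth wit D T L
      A21i(1) Q33i(1) assms(31,34))+

  have BV3: "B * V3 \<in> carrier_mat n k" and C: "B * V3 * T_plus \<in> carrier_mat n n_plus"
    using mult_carrier_mat[OF B V3] mult_carrier_mat[OF mult_carrier_mat[OF B V3] T] by auto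
  have C_mult: "B * V3 *\<^sub>v (T_plus *\<^sub>v z) = (B * V3 * T_plus) *\<^sub>v z" if "z \<in> carrier_vec n_plus" for z
    using assoc_mult_mat_vec[OF BV3 T that] by simp
  have C_inj: "z = 0\<^sub>v n_plus" if "z \<in> carrier_vec n_plus" "B * V3 *\<^sub>v (T_plus *\<^sub>v z) = 0\<^sub>v n" for z
    using lin_indpt_cols_injective[OF C full_rank_lin_indpt_cols[OF C assms(37)] that(1)] that(2)
      C_mult[OF that(1)] by simp
  obtain z0 where z0: "z0 \<in> carrier_vec n_plus" "g = (B * V3 * T_plus) *\<^sub>v z0"
    by (rule col_space_memD[OF C assms(38)])
  then have Bz0: "B * V3 *\<^sub>v (T_plus *\<^sub>v z0) = g"
    using C_mult by simp
  define w where "w y = mode_profile *\<^sub>v decay_modes z0 y" for y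
  have e0: "decay_modes z0 0 = z0"
    using z0(1) unfolding decay_modes_def by (intro eq_vecI) auto
  have w_sol: "decaying_solution A Q w"
    unfolding w_def[abs_def] by (rule mode_solution_decays)
  have V3w: "V3\<^sup>T *\<^sub>v w y = T_plus *\<^sub>v decay_modes z0 y" for y
    unfolding w_def by (rule mode_profile_blocks(3)[OF decay_modes_carrier])
  have w_bc: "B * V3 *\<^sub>v (V3\<^sup>T *\<^sub>v w 0) = g"
    unfolding V3w e0 by (rule Bz0)
  have unique: "w' y = w y"
    if w': "decaying_solution A Q w'" and bc: "B * V3 *\<^sub>v (V3\<^sup>T *\<^sub>v w' 0) = g" and y: "0 \<le> y" for w' y
  proof -
    define u where "u y = w' y - w y" for y
    have u: "decaying_solution A Q u"
      unfolding u_def[abs_def] by (rule decaying_solution_diff[OF A Q w' w_sol])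
    have c: "w' y \<in> carrier_vec N" "w y \<in> carrier_vec N" if "0 \<le> y" for y
      using u_carrier[OF w' that] u_carrier[OF w_sol that] by auto
    have V3c: "V3\<^sup>T *\<^sub>v w' 0 \<in> carrier_vec k" "V3\<^sup>T *\<^sub>v w 0 \<in> carrier_vec k"
      using c[of 0] V3t by auto
    have V3u: "V3\<^sup>T *\<^sub>v u 0 = V3\<^sup>T *\<^sub>v w' 0 - V3\<^sup>T *\<^sub>v w 0"
      unfolding u_def using c[of 0] by (intro mult_minus_distrib_mat_vec[OF V3t]) auto
    obtain z where z: "z \<in> carrier_vec n_plus" "V3\<^sup>T *\<^sub>v u 0 = T_plus *\<^sub>v z"
      using initial_value_in_range[OF u] by blast
    have "B * V3 *\<^sub>v (V3\<^sup>T *\<^sub>v u 0) = g - g"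
      unfolding V3u mult_minus_distrib_mat_vec[OF BV3 V3c] bc w_bc ..
    then have "B * V3 *\<^sub>v (T_plus *\<^sub>v z) = 0\<^sub>v n"
      using assms(36) z(2) by simp
    then have "V3\<^sup>T *\<^sub>v u 0 = 0\<^sub>v k"
      using C_inj[OF z(1)] z(2) mult_zero_vec[OF T] by simp
    then have "u y = 0\<^sub>v N"
      by (rule solution_zero[OF u _ y])
    then show ?thesis
      using eq_vec_of_diff_zero[OF c[OF y]] unfolding u_def by blast
  qed
  have z_unique: "z' = z0"
    if z': "z' \<in> carrier_vec n_plus" and eq: "B * V3 *\<^sub>v (T_plus *\<^sub>v z') = g" for z'
  proof -
    have "B * V3 *\<^sub>v (T_plus *\<^sub>v (z' - z0)) = (B * V3 * T_plus) *\<^sub>v z' - (B * V3 * T_plus) *\<^sub>v z0"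
      using C_mult[of "z' - z0"] mult_minus_distrib_mat_vec[OF C z' z0(1)] z' z0(1) by simp
    also have "\<dots> = 0\<^sub>v n"
      using eq C_mult[OF z'] z0(2) assms(36) by simp
    finally show ?thesis
      using C_inj[of "z' - z0"] eq_vec_of_diff_zero[OF z' z0(1)] z' z0(1) by simp
  qed
  have exp: "mat_exp (- (y \<cdot>\<^sub>m inv_mat L_plus)) *\<^sub>v z0 = decay_modes z0 y" for y
    unfolding decay_modes_def
    by (rule mat_exp_decay_mult_vec[OF L _ z0(1)]) (use assms(32) in fastforce)
  have formulas: "V2\<^sup>T *\<^sub>v w y = 0\<^sub>v p \<and>
      V3\<^sup>T *\<^sub>v w y = T_plus *\<^sub>v (mat_exp (- (y \<cdot>\<^sub>m inv_mat L_plus)) *\<^sub>v z0) \<and>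
      (\<exists>I. has_integral_vec r
             (\<lambda>s. inv_mat A21 * U2\<^sup>T * Q * V3 *\<^sub>v (V3\<^sup>T *\<^sub>v w s)) I {y..} \<and>
           V1\<^sup>T *\<^sub>v w y = - (inv_mat A21 * U2\<^sup>T * A * V3 *\<^sub>v (V3\<^sup>T *\<^sub>v w y)) + I)" for y
  proof (intro conjI exI)
    show "V2\<^sup>T *\<^sub>v w y = 0\<^sub>v p"
      unfolding w_def by (rule mode_profile_blocks(2)[OF decay_modes_carrier])
    show "V3\<^sup>T *\<^sub>v w y = T_plus *\<^sub>v (mat_exp (- (y \<cdot>\<^sub>m inv_mat L_plus)) *\<^sub>v z0)"
      unfolding exp by (rule V3w)
    show "has_integral_vec r (\<lambda>s. inv_mat A21 * U2\<^sup>T * Q * V3 *\<^sub>v (V3\<^sup>T *\<^sub>v w s))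
        (outer_forcing *\<^sub>v (T_plus *\<^sub>v (L_plus *\<^sub>v decay_modes z0 y))) {y..}"
      using mode_solution_integral[of z0 y] unfolding outer_forcing_def w_def .
    show "V1\<^sup>T *\<^sub>v w y = - (inv_mat A21 * U2\<^sup>T * A * V3 *\<^sub>v (V3\<^sup>T *\<^sub>v w y))
        + outer_forcing *\<^sub>v (T_plus *\<^sub>v (L_plus *\<^sub>v decay_modes z0 y))"
      unfolding V3w using mode_profile_blocks(1)[OF decay_modes_carrier]
      unfolding outer_coupling_def w_def .
  qed
  show ?thesis
    using w_sol w_bc unique z0(1) Bz0 z_unique formulas
    by (intro exI[of _ w] exI[of _ z0]) blast
qed

end
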